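(* Let $T$ be a triangulation on at least four vertices. Then $$c(T) \le \sum_{G \in \mathcal{P}(T)} c(G).$$ Moreover, if every planar $4$-connected triangulation on $m$ vertices (for every $m$) admits a cycle double cover of size at most $m-2$, then $$c(T) \le 3\,|\mathcal{P}_{K_4}(T)| + \sum_{G \in \mathcal{P}_4(T)} (|V(G)|-2).$$
   Context: A cycle is a connected $2$-regular graph. A cycle double cover (CDC) of a graph $G$ is a multiset of cycles of $G$ such that every edge lies in exactly two members, counted with multiplicity; its size is the number of cycles with multiplicity. $c(G)$ is the minimum size of a CDC of $G$ ($c(G)=\infty$ if none exists). A triangulation is a simple planar graph embedded in the plane in which every face boundary is a triangle. A separating triangle is a triangle whose removal disconnects the graph; for such a triangle $S$, $\mathrm{Int}(S)$ (resp. $\mathrm{Ext}(S)$) is the plane graph formed by $S$ together with its interior (resp. exterior), again a triangulation. The multiset of pieces $\mathcal{P}(T)$ (Jackson–Yu decomposition) is obtained by repeatedly splitting along separating triangles: if $T$ has no separating triangle, $\mathcal{P}(T)=\{T\}$; otherwise, for a separating triangle $S$, $\mathcal{P}(T)$ is the multiset union of $\mathcal{P}(\mathrm{Int}(S))$ and $\mathcal{P}(\mathrm{Ext}(S))$ (a copy of $S$ is kept in each part). This multiset is independent of the choices made, and each piece is either $4$-connected or isomorphic to $K_4$. $\mathcal{P}_4(T)$ is the multiset of $4$-connected pieces and $\mathcal{P}_{K_4}(T)$ the multiset of pieces isomorphic to $K_4$. *)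

theory Defs
  imports "HOL-Analysis.Analysis" "HOL-Library.Multiset" "HOL-Library.Extended_Nat"
begin

subsection \<open>Finite simple graphs\<close>

record 'a ugraph =
  uverts :: "'a set"
  uedges :: "'a set set"

definition simple_graph :: "'a ugraph \<Rightarrow> bool" where
  "simple_graph G \<longleftrightarrow> finite (uverts G) \<and> (\<forall>e\<in>uedges G. e \<subseteq> uverts G \<and> card e = 2)"

definition subgraph :: "'a ugraph \<Rightarrow> 'a ugraph \<Rightarrow> bool" where
  "subgraph H G \<longleftrightarrow> uverts H \<subseteq> uverts G \<and> uedges H \<subseteq> uedges G"

definition udegree :: "'a ugraph \<Rightarrow> 'a \<Rightarrow> nat" where
  "udegree G v = card {e \<in> uedges G. v \<in> e}"

text \<open>The graph without vertices satisfies the following condition; where this matters,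
  non-emptiness is required separately.\<close>

definition connected_graph :: "'a ugraph \<Rightarrow> bool" where
  "connected_graph G \<longleftrightarrow>
     (\<forall>u\<in>uverts G. \<forall>v\<in>uverts G. (u, v) \<in> {(x, y). {x, y} \<in> uedges G}\<^sup>*)"

definition delete_verts :: "'a ugraph \<Rightarrow> 'a set \<Rightarrow> 'a ugraph" where
  "delete_verts G X = \<lparr>uverts = uverts G - X, uedges = {e \<in> uedges G. e \<inter> X = {}}\<rparr>"

definition k_connected :: "nat \<Rightarrow> 'a ugraph \<Rightarrow> bool" where
  "k_connected k G \<longleftrightarrow> card (uverts G) > k \<and>
     (\<forall>X\<subseteq>uverts G. card X < k \<longrightarrow> connected_graph (delete_verts G X))"

definition graph_iso :: "'a ugraph \<Rightarrow> 'b ugraph \<Rightarrow> bool" where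
  "graph_iso G H \<longleftrightarrow>
     (\<exists>f. bij_betw f (uverts G) (uverts H) \<and> uedges H = (\<lambda>e. f ` e) ` uedges G)"

definition complete_graph :: "nat \<Rightarrow> nat ugraph" where
  "complete_graph n = \<lparr>uverts = {..<n}, uedges = {e. e \<subseteq> {..<n} \<and> card e = 2}\<rparr>"

definition is_cycle :: "'a ugraph \<Rightarrow> bool" where
  "is_cycle C \<longleftrightarrow> simple_graph C \<and> uverts C \<noteq> {} \<and> connected_graph C \<and>
     (\<forall>v\<in>uverts C. udegree C v = 2)"

definition cycle_double_cover :: "'a ugraph \<Rightarrow> 'a ugraph multiset \<Rightarrow> bool" where
  "cycle_double_cover G M \<longleftrightarrow>
     (\<forall>C\<in>#M. is_cycle C \<and> subgraph C G) \<and>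
     (\<forall>e\<in>uedges G. size {#C \<in># M. e \<in> uedges C#} = 2)"

text \<open>The infimum of the empty set in \<^typ>\<open>enat\<close> is \<open>\<infinity>\<close>.\<close>

definition cdc_number :: "'a ugraph \<Rightarrow> enat" where
  "cdc_number G = (INF M\<in>{M. cycle_double_cover G M}. enat (size M))"

subsection \<open>Plane graphs\<close>

text \<open>The plane is \<open>\<complex>\<close>. Vertices are points and edges are arcs, as point sets; the ends
  of an arc \<open>e\<close> are the two points of \<open>e \<inter> pverts G\<close>.\<close>

record plane_graph =
  pverts :: "complex set"
  parcs :: "complex set set"

definition is_plane_graph :: "plane_graph \<Rightarrow> bool" where
  "is_plane_graph G \<longleftrightarrow>
     finite (pverts G) \<and> finite (parcs G) \<and>
     (\<forall>e\<in>parcs G. \<exists>g. arc g \<and> path_image g = e \<and>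
        e \<inter> pverts G = {pathstart g, pathfinish g}) \<and>
     inj_on (\<lambda>e. e \<inter> pverts G) (parcs G) \<and>
     (\<forall>e\<in>parcs G. \<forall>f\<in>parcs G. e \<noteq> f \<longrightarrow> e \<inter> f \<subseteq> pverts G)"

definition underlying :: "plane_graph \<Rightarrow> complex ugraph" where
  "underlying G = \<lparr>uverts = pverts G, uedges = (\<lambda>e. e \<inter> pverts G) ` parcs G\<rparr>"

definition point_set :: "plane_graph \<Rightarrow> complex set" where
  "point_set G = pverts G \<union> \<Union>(parcs G)"

definition faces :: "plane_graph \<Rightarrow> complex set set" where
  "faces G = components (- point_set G)"

definition triangle_of :: "plane_graph \<Rightarrow> plane_graph \<Rightarrow> bool" where
  "triangle_of S G \<longleftrightarrow> pverts S \<subseteq> pverts G \<and> parcs S \<subseteq> parcs G \<and>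
     is_cycle (underlying S) \<and> card (pverts S) = 3"

definition plane_triangulation :: "plane_graph \<Rightarrow> bool" where
  "plane_triangulation T \<longleftrightarrow> is_plane_graph T \<and>
     (\<forall>F\<in>faces T. \<exists>S. triangle_of S T \<and> frontier F = point_set S)"

definition separating_triangle :: "plane_graph \<Rightarrow> plane_graph \<Rightarrow> bool" where
  "separating_triangle S T \<longleftrightarrow> triangle_of S T \<and>
     \<not> connected_graph (delete_verts (underlying T) (pverts S))"

definition restrict_plane :: "plane_graph \<Rightarrow> complex set \<Rightarrow> plane_graph" where
  "restrict_plane T R = \<lparr>pverts = pverts T \<inter> R, parcs = {e \<in> parcs T. e \<subseteq> R}\<rparr>"

definition Int_triangle :: "plane_graph \<Rightarrow> plane_graph \<Rightarrow> plane_graph" where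
  "Int_triangle T S = restrict_plane T (point_set S \<union> inside (point_set S))"

definition Ext_triangle :: "plane_graph \<Rightarrow> plane_graph \<Rightarrow> plane_graph" where
  "Ext_triangle T S = restrict_plane T (point_set S \<union> outside (point_set S))"

text \<open>\<open>pieces T P\<close>: some sequence of choices of separating triangles decomposes \<open>T\<close> into
  the multiset \<open>P\<close>.\<close>

inductive pieces :: "plane_graph \<Rightarrow> plane_graph multiset \<Rightarrow> bool" where
  whole: "(\<nexists>S. separating_triangle S T) \<Longrightarrow> pieces T {#T#}"
| split: "separating_triangle S T \<Longrightarrow> pieces (Int_triangle T S) P \<Longrightarrow>
    pieces (Ext_triangle T S) Q \<Longrightarrow> pieces T (P + Q)"

definition four_connected_pieces :: "plane_graph multiset \<Rightarrow> plane_graph multiset" where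
  "four_connected_pieces P = {#G \<in># P. k_connected 4 (underlying G)#}"

definition K4_pieces :: "plane_graph multiset \<Rightarrow> plane_graph multiset" where
  "K4_pieces P = {#G \<in># P. graph_iso (underlying G) (complete_graph 4)#}"

end

theory Submission
  imports Defs
begin

text \<open>Let \<open>S\<close> be a separating triangle and take cycle double covers of \<open>Int(S)\<close> and \<open>Ext(S)\<close>.
  Their union covers every edge of \<open>S\<close> four times. If a cycle of the first cover and a cycle of
  the second one share an edge, their symmetric difference is a union of at most two cycles, since
  the two cycles meet only in the three vertices of \<open>S\<close>. One of the covers contains \<open>S\<close> twice, and
  both copies can be dropped, or cycles of the two covers can be paired so that every edge of \<open>S\<close>
  is shared by exactly one pair; replacing the pairs by their symmetric differences gives a cycle
  double cover of \<open>T\<close> with no more cycles than both covers together.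

  For the second bound, let \<open>X\<close> be a set of vertices of a triangulation. As vertices outside \<open>X\<close> on
  a common face are adjacent, distinct components of \<open>T - X\<close> lie in distinct components of the
  complement of the drawing of \<open>T[X]\<close>. With at most three vertices, such a drawing separates the
  plane only if it is a triangle. So a piece has four vertices and is \<open>K\<^sub>4\<close>, or it is 4-connected.\<close>

subsection \<open>Cycles as vertex lists\<close>

text \<open>Why merging pairs gives exact multiplicities: merging two cycles subtracts 2 from every
  edge that both contain, and such edges lie on \<open>S\<close>. An edge of \<open>S\<close> starts
  with multiplicity 4, so it must be common to exactly one merged pair. The obstacle is that a pair
  chosen for one edge of \<open>S\<close> may contain a second one. It then has to be the pair
  chosen for that edge as well, and no cycle may be consumed by two different pairs. This is a
  selection problem for three 2-element sets on each side, namely the cycles through the three edges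
  of \<open>S\<close>. It is solvable unless one side repeats the same set three times; in that
  exception the two cycles contain all of \<open>S\<close>, and a cycle containing a cycle equals
  it.

  On the topological side, components of \<open>T - X\<close> are thickened to open sets. Openness
  relies on there being finitely many faces, which holds because each face is a side of one of
  finitely many triangles.\<close>

text \<open>Edges are kept with multiplicity because the closed walk on \<open>[x, y]\<close> uses
  \<open>{x, y}\<close> twice, and such degenerate walks arise when cycles are merged.\<close>

fun walk_edges :: "'a list \<Rightarrow> 'a set multiset" where
  "walk_edges (x # y # zs) = add_mset {x, y} (walk_edges (y # zs))"
| "walk_edges _ = {#}"

lemma walk_edges_append: "walk_edges (xs @ z # ys) = walk_edges (xs @ [z]) + walk_edges (z # ys)"
  by (induction xs rule: walk_edges.induct) auto

lemma walk_edges_rev: "walk_edges (rev xs) = walk_edges xs"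
proof (induction xs rule: walk_edges.induct)
  case (1 x y zs)
  have "walk_edges (rev (x # y # zs)) = walk_edges (rev zs @ [y]) + walk_edges [y, x]"
    using walk_edges_append[of "rev zs" y "[x]"] by simp
  then show ?case using 1 by (simp add: insert_commute)
qed auto

lemma walk_edges_subset: "e \<in># walk_edges xs \<Longrightarrow> e \<subseteq> set xs"
  by (induction xs rule: walk_edges.induct) auto

lemma walk_edges_card: "distinct xs \<Longrightarrow> e \<in># walk_edges xs \<Longrightarrow> card e = 2"
  by (induction xs rule: walk_edges.induct) auto

lemma walk_edges_count_le_1: "distinct xs \<Longrightarrow> count (walk_edges xs) e \<le> 1"
proof (induction xs rule: walk_edges.induct)
  case (1 x y zs)
  have "{x, y} \<notin># walk_edges (y # zs)"
    using walk_edges_subset[of "{x, y}" "y # zs"] 1 by auto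
  then show ?case using 1 by (auto simp: count_eq_zero_iff)
qed auto

definition closed_walk_edges :: "'a list \<Rightarrow> 'a set multiset" where
  "closed_walk_edges xs = walk_edges (xs @ [hd xs])"

definition list_cycle :: "'a list \<Rightarrow> 'a ugraph" where
  "list_cycle xs = \<lparr>uverts = set xs, uedges = set_mset (closed_walk_edges xs)\<rparr>"

text \<open>Any vertex can be moved to the head, so local statements about a closed walk need a
  proof only there.\<close>

lemma closed_walk_edges_rotate: "closed_walk_edges (xs @ ys) = closed_walk_edges (ys @ xs)"
proof (cases xs; cases ys)
  fix x xs' y ys' assume "xs = x # xs'" "ys = y # ys'"
  then show ?thesis
    using walk_edges_append[of xs y "ys' @ [x]"] walk_edges_append[of ys x "xs' @ [y]"]
    by (simp add: closed_walk_edges_def)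
qed (auto simp: closed_walk_edges_def)

lemma closed_walk_edges_Cons_snoc:
  "closed_walk_edges (v # y # zs @ [w]) = {#{v, y}, {v, w}#} + walk_edges (y # zs @ [w])"
  using walk_edges_append[of "v # y # zs" w "[v]"]
  by (simp add: closed_walk_edges_def insert_commute)

lemma obtain_Cons_snoc:
  assumes "length xs \<ge> 3" obtains v y zs w where "xs = v # y # zs @ [w]"
proof -
  obtain v y zs' where "xs = v # y # zs'" "zs' \<noteq> []"
    using assms by (cases xs; cases "tl xs"; cases "tl (tl xs)") auto
  then show ?thesis using that by (metis append_butlast_last_id)
qed

text \<open>From length 3 on, the first edge and the closing edge at the head differ; at length 2
  they coincide.\<close>

lemma closed_walk_edges_count_le_1:
  assumes "distinct xs" "length xs \<ge> 3" shows "count (closed_walk_edges xs) e \<le> 1"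
proof -
  obtain v y zs w where xs: "xs = v # y # zs @ [w]" using assms obtain_Cons_snoc by blast
  have "{v, y} \<notin># walk_edges (y # zs @ [w])" "{v, w} \<notin># walk_edges (y # zs @ [w])"
    using walk_edges_subset[of _ "y # zs @ [w]"] assms by (fastforce simp: xs)+
  moreover have "{v, y} \<noteq> {v, w}" using assms by (auto simp: xs doubleton_eq_iff)
  moreover have "count (walk_edges (y # zs @ [w])) e \<le> 1"
    using assms by (intro walk_edges_count_le_1) (auto simp: xs)
  ultimately show ?thesis
    by (auto simp: xs closed_walk_edges_Cons_snoc count_eq_zero_iff)
qed

lemma closed_walk_edges_at:
  assumes "distinct (v # y # zs @ [w])"
  shows "{e. e \<in># closed_walk_edges (v # y # zs @ [w]) \<and> v \<in> e} = {{v, y}, {v, w}}"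
  using assms walk_edges_subset[of _ "y # zs @ [w]"]
  by (auto simp: closed_walk_edges_Cons_snoc)

lemma walk_reachable:
  assumes "\<And>e. e \<in># walk_edges (x # xs) \<Longrightarrow> e \<in> E" "v \<in> set (x # xs)"
  shows "(x, v) \<in> {(x, y). {x, y} \<in> E}\<^sup>*"
  using assms
proof (induction xs arbitrary: x)
  case (Cons y ys)
  then show ?case
  proof (cases "v = x")
    case False
    then have "(y, v) \<in> {(x, y). {x, y} \<in> E}\<^sup>*" using Cons by auto
    moreover have "{x, y} \<in> E" using Cons.prems by auto
    ultimately show ?thesis by (intro converse_rtrancl_into_rtrancl[of x y]) auto
  qed auto
qed auto

lemma sym_adjacency: "sym ({(x, y). {x, y} \<in> E}\<^sup>*)"
  by (intro sym_rtrancl) (auto simp: sym_def insert_commute)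

lemma is_cycle_list_cycle:
  assumes "distinct xs" "length xs \<ge> 3" shows "is_cycle (list_cycle xs)"
proof -
  obtain v y zs w where xs: "xs = v # y # zs @ [w]" using assms obtain_Cons_snoc by blast
  let ?E = "uedges (list_cycle xs)"
  have 1: "e \<subseteq> set xs \<and> card e = 2" if "e \<in> ?E" for e
  proof -
    have "e = {v, y} \<or> e = {v, w} \<or> e \<in># walk_edges (y # zs @ [w])"
      using that by (auto simp: list_cycle_def xs closed_walk_edges_Cons_snoc)
    then show ?thesis
      using walk_edges_subset[of e "y # zs @ [w]"] walk_edges_card[of "y # zs @ [w]" e] assms
      by (auto simp: xs)
  qed
  have reach: "(v, u) \<in> {(x, y). {x, y} \<in> ?E}\<^sup>*" if "u \<in> set xs" for u
    unfolding xs
    by (rule walk_reachable[of v "y # zs @ [w]"])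
      (use that in \<open>auto simp: list_cycle_def xs closed_walk_edges_Cons_snoc\<close>)
  have conn: "connected_graph (list_cycle xs)"
    unfolding connected_graph_def
  proof (intro ballI)
    fix a b assume "a \<in> uverts (list_cycle xs)" "b \<in> uverts (list_cycle xs)"
    then have "a \<in> set xs" "b \<in> set xs" by (auto simp: list_cycle_def)
    then show "(a, b) \<in> {(x, y). {x, y} \<in> ?E}\<^sup>*"
      using rtrancl_trans[OF symD[OF sym_adjacency reach] reach] by blast
  qed
  have deg: "udegree (list_cycle xs) u = 2" if u: "u \<in> set xs" for u
  proof -
    \<comment> \<open>Rotating \<open>u\<close> to the head reduces its degree to
      \<open>closed_walk_edges_at\<close>.\<close>
    obtain as bs where ab: "xs = as @ u # bs" using split_list[OF u] by blast
    then have "length ((u # bs) @ as) \<ge> 3" using assms by simp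
    then obtain v' y' zs' w' where r: "(u # bs) @ as = v' # y' # zs' @ [w']"
      using obtain_Cons_snoc by blast
    then have "u = v'" by simp
    have "closed_walk_edges xs = closed_walk_edges (u # y' # zs' @ [w'])"
      using closed_walk_edges_rotate[of as "u # bs"] r ab by simp
    moreover have d: "distinct (u # y' # zs' @ [w'])"
    proof -
      have "distinct ((u # bs) @ as)" using assms(1) by (auto simp: ab)
      then have "distinct (v' # y' # zs' @ [w'])" by (simp only: r)
      then show ?thesis by (simp only: \<open>u = v'\<close>)
    qed
    ultimately have "{e \<in> ?E. u \<in> e} = {{u, y'}, {u, w'}}"
      using closed_walk_edges_at[OF d] by (simp add: list_cycle_def)
    then show ?thesis using d by (auto simp: udegree_def doubleton_eq_iff)
  qed
  show ?thesis using 1 conn deg xs by (auto simp: is_cycle_def simple_graph_def list_cycle_def)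
qed

text \<open>At a vertex of \<open>D\<close> both degrees are 2, so \<open>D\<close> has every edge
  of \<open>C\<close> there. Connectedness of \<open>C\<close> spreads this from one vertex of
  \<open>D\<close> to all of \<open>C\<close>.\<close>

lemma is_cycle_subgraph_eq:
  fixes C D :: "'a ugraph"
  assumes C: "is_cycle C" and D: "is_cycle D" and sub: "subgraph D C"
  shows "D = C"
proof -
  have fin: "finite (uedges C)"
    using C unfolding is_cycle_def simple_graph_def
    by (meson finite_Pow_iff finite_subset PowI subsetI)
  have eq: "{e \<in> uedges D. v \<in> e} = {e \<in> uedges C. v \<in> e}" if "v \<in> uverts D" for v
  proof (rule card_subset_eq)
    show "card {e \<in> uedges D. v \<in> e} = card {e \<in> uedges C. v \<in> e}"
      using C D sub that by (auto simp: is_cycle_def udegree_def subgraph_def)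
  qed (use fin sub in \<open>auto simp: subgraph_def\<close>)
  obtain d where d: "d \<in> uverts D" using D by (auto simp: is_cycle_def)
  have DC: "uverts D \<subseteq> uverts C" "uedges D \<subseteq> uedges C" using sub by (auto simp: subgraph_def)
  have "v \<in> uverts D" if "v \<in> uverts C" for v
  proof -
    have "(d, v) \<in> {(x, y). {x, y} \<in> uedges C}\<^sup>*"
      using C DC d that by (auto simp: is_cycle_def connected_graph_def)
    then show ?thesis
    proof induction
      case (step y z)
      then have "{y, z} \<in> uedges D" using eq[of y] by auto
      then show ?case using D by (auto simp: is_cycle_def simple_graph_def)
    qed (use d in auto)
  qed
  then have V: "uverts D = uverts C" using DC by auto
  have "e \<in> uedges D" if "e \<in> uedges C" for e
  proof -
    have "e \<subseteq> uverts C" "card e = 2" using C that by (auto simp: is_cycle_def simple_graph_def)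
    then obtain v where "v \<in> e" "v \<in> uverts D" using V by (metis card_2_iff insertI1 subsetD)
    then show ?thesis using eq[of v] that by auto
  qed
  then have "uedges D = uedges C" using DC by auto
  then show ?thesis using V by simp
qed

text \<open>A longest path of \<open>C\<close> that starts with the given edge must close up,
  because degree 2 leaves its last vertex no other way out. The closed path is a cycle inside
  \<open>C\<close>, hence all of \<open>C\<close>.\<close>

lemma is_cycle_imp_list_cycle:
  assumes C: "is_cycle C" and ab: "{a, b} \<in> uedges C"
  obtains xs where "C = list_cycle (a # xs @ [b])" "distinct (a # xs @ [b])" "xs \<noteq> []"
proof -
  have sg: "finite (uverts C)" "\<And>e. e \<in> uedges C \<Longrightarrow> e \<subseteq> uverts C \<and> card e = 2"
    and deg: "\<And>v. v \<in> uverts C \<Longrightarrow> card {e \<in> uedges C. v \<in> e} = 2"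
    using C by (auto simp: is_cycle_def simple_graph_def udegree_def)
  have finE: "finite (uedges C)"
    using sg by (meson finite_Pow_iff finite_subset PowI subsetI)
  \<comment> \<open>The path starts with \<open>b, a\<close>, so the given edge stays its first edge
    while \<open>ws\<close> grows at the far end.\<close>
  define Q where "Q ws \<longleftrightarrow> distinct (b # a # ws) \<and> set (b # a # ws) \<subseteq> uverts C \<and>
    set_mset (walk_edges (b # a # ws)) \<subseteq> uedges C" for ws
  have ne: "a \<noteq> b" using sg(2)[OF ab] by auto
  have Q0: "Q []" using ab ne sg(2)[OF ab] by (auto simp: Q_def insert_commute)
  have bound: "length ws < Suc (card (uverts C))" if "Q ws" for ws
  proof -
    have "card (set (b # a # ws)) \<le> card (uverts C)"
      using that sg(1) by (intro card_mono) (auto simp: Q_def)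
    then show ?thesis using that unfolding Q_def by (subst (asm) distinct_card) auto
  qed
  obtain ws where ws: "Q ws" and mx: "\<And>us. Q us \<Longrightarrow> length us \<le> length ws"
    using ex_has_greatest_nat[of Q "[]" length "Suc (card (uverts C))"] Q0 bound
    by metis
  define L where "L = b # a # ws"
  obtain L' p w where L: "L = L' @ [p, w]"
  proof -
    obtain L'' w' where 1: "L = L'' @ [w']" by (metis L_def list.distinct(1) rev_exhaust)
    then have "L'' \<noteq> []" by (auto simp: L_def)
    then obtain L' p' where "L'' = L' @ [p']" by (metis rev_exhaust)
    then show ?thesis using that 1 by auto
  qed
  have dL: "distinct L" "set L \<subseteq> uverts C" "set_mset (walk_edges L) \<subseteq> uedges C"
    using ws by (auto simp: Q_def L_def)
  have pw: "{p, w} \<in> uedges C"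
    using dL(3) walk_edges_append[of L' p "[w]"] by (auto simp: L)
  have wC: "w \<in> uverts C" using dL(2) L by auto
  \<comment> \<open>Degree 2 supplies a second edge at the end of the path; maximality then puts its
    other end \<open>d\<close> back on the path.\<close>
  have "\<exists>e. e \<in> uedges C \<and> w \<in> e \<and> e \<noteq> {p, w}"
  proof (rule ccontr)
    assume "\<not> ?thesis"
    then have "{e \<in> uedges C. w \<in> e} = {{p, w}}" using pw by auto
    then show False using deg[OF wC] by simp
  qed
  then obtain e where e: "e \<in> uedges C" "w \<in> e" "e \<noteq> {p, w}" by blast
  obtain d where d: "e = {d, w}" "d \<noteq> w"
    using sg(2)[OF e(1)] e(2) by (metis card_2_iff insertE insert_commute singletonD)
  have dp: "d \<noteq> p" using e d by auto
  have dLin: "d \<in> set L"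
  proof (rule ccontr)
    assume n: "d \<notin> set L"
    have "walk_edges (L @ [d]) = walk_edges L + {#{w, d}#}"
      using walk_edges_append[of "L' @ [p]" w "[d]"] by (simp add: L)
    moreover have "{w, d} \<in> uedges C" using e(1) d(1) by (simp add: insert_commute)
    moreover have "d \<in> uverts C" using sg(2)[OF e(1)] d(1) by blast
    ultimately have "distinct (L @ [d]) \<and> set (L @ [d]) \<subseteq> uverts C \<and>
        set_mset (walk_edges (L @ [d])) \<subseteq> uedges C"
      using n dL by simp
    then have "Q (ws @ [d])"
      unfolding Q_def L_def by simp
    then show False using mx[of "ws @ [d]"] by simp
  qed
  \<comment> \<open>Otherwise \<open>d\<close> has a predecessor \<open>q\<close> and a successor
    \<open>n\<close> on the path, and \<open>w\<close> is a third neighbour. That \<open>n\<close>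
    differs from \<open>w\<close> is due to \<open>d \<noteq> p\<close>.\<close>
  have "d = b"
  proof (rule ccontr)
    assume "d \<noteq> b"
    obtain us vs where uv: "L = us @ d # vs" using split_list[OF dLin] by blast
    have "us \<noteq> []" using uv \<open>d \<noteq> b\<close> by (cases us) (simp_all add: L_def)
    then obtain us' q where us: "us = us' @ [q]" by (metis rev_exhaust)
    have "vs \<noteq> []"
    proof
      assume "vs = []" then have "last L = d" using uv by simp
      then show False using d L by simp
    qed
    then obtain n vs' where vs: "vs = n # vs'" by (meson list.exhaust)
    have "n \<noteq> w"
    proof
      assume "n = w"
      have "vs' = []"
      proof (rule ccontr)
        assume "vs' \<noteq> []"
        then have "last L = last vs'" using uv vs by simp
        then have "w \<in> set vs'" using \<open>vs' \<noteq> []\<close> L by auto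
        then show False using dL(1) \<open>n = w\<close> unfolding uv vs by simp
      qed
      then have "L = (us @ [d]) @ [w]" "L = (L' @ [p]) @ [w]" using uv vs L \<open>n = w\<close> by auto
      then show False using dp by simp
    qed
    have "walk_edges L = walk_edges (us' @ [q]) + walk_edges (q # d # vs)"
      using walk_edges_append[of us' q "d # vs"] by (simp add: uv us)
    then have "{q, d} \<in> uedges C" "{d, n} \<in> uedges C" using dL(3) vs by simp_all
    then have "{{q, d}, {d, n}, {d, w}} \<subseteq> {e \<in> uedges C. d \<in> e}" using e(1) d(1) by simp
    then have "card {{q, d}, {d, n}, {d, w}} \<le> card {e \<in> uedges C. d \<in> e}"
      using finE by (intro card_mono) auto
    moreover have "card {e \<in> uedges C. d \<in> e} = 2" using deg dL(2) dLin by blast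
    moreover have "q \<noteq> d" "n \<noteq> d" using dL(1) unfolding uv us vs by auto
    moreover have "q \<noteq> n" using dL(1) unfolding uv us vs by auto
    moreover have "q \<noteq> w"
    proof
      assume "q = w"
      moreover have "last L = last vs" using uv \<open>vs \<noteq> []\<close> by simp
      then have "w \<in> set vs" using L \<open>vs \<noteq> []\<close> by auto
      ultimately show False using dL(1) unfolding uv us by simp
    qed
    ultimately show False using \<open>n \<noteq> w\<close> d(2) by (simp add: doubleton_eq_iff card_insert_if)
  qed
  have wsne: "ws \<noteq> []"
  proof
    assume "ws = []"
    then have "L = [b, a]" by (simp add: L_def)
    then show False using L dp \<open>d = b\<close> by (cases L') auto
  qed
  have "hd L = b" by (simp add: L_def)
  then have "closed_walk_edges L = walk_edges L + {#{w, b}#}"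
    unfolding closed_walk_edges_def using walk_edges_append[of "L' @ [p]" w "[b]"]
    by (simp only: L append_assoc append_Cons append_Nil walk_edges.simps)
  then have "subgraph (list_cycle L) C"
    using dL e d \<open>d = b\<close> by (auto simp: subgraph_def list_cycle_def insert_commute)
  moreover have "is_cycle (list_cycle L)"
    using dL(1) wsne by (intro is_cycle_list_cycle) (auto simp: L_def Suc_le_eq)
  ultimately have "list_cycle L = C" using C is_cycle_subgraph_eq by blast
  \<comment> \<open>With \<open>b\<close> at the end, \<open>{a, b}\<close> is the closing edge, the
    one that disappears when two cycles are merged.\<close>
  moreover have "list_cycle L = list_cycle (a # ws @ [b])"
    using closed_walk_edges_rotate[of "[b]" "a # ws"] by (auto simp: list_cycle_def L_def)
  ultimately show ?thesis using that[of ws] wsne dL(1) by (auto simp: L_def)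
qed

subsection \<open>Merging two cycles along a common edge\<close>

definition edge_mult :: "'a ugraph multiset \<Rightarrow> 'a set \<Rightarrow> nat" where
  "edge_mult M e = size {#C \<in># M. e \<in> uedges C#}"

lemma edge_mult_simps [simp]:
  "edge_mult {#} e = 0"
  "edge_mult (add_mset C M) e = of_bool (e \<in> uedges C) + edge_mult M e"
  "edge_mult (M + N) e = edge_mult M e + edge_mult N e"
  by (auto simp: edge_mult_def)

lemma of_bool_mem_list_cycle:
  assumes "distinct xs" "length xs \<ge> 3"
  shows "of_bool (e \<in> uedges (list_cycle xs)) = count (closed_walk_edges xs) e"
proof (cases "e \<in># closed_walk_edges xs")
  case True
  then have "count (closed_walk_edges xs) e = 1"
    using closed_walk_edges_count_le_1[OF assms, of e] count_greater_zero_iff[of _ e]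
    by (metis One_nat_def le_antisym Suc_leI)
  then show ?thesis using True by (simp add: list_cycle_def)
qed (auto simp: list_cycle_def count_eq_zero_iff)

text \<open>Two paths from \<open>x\<close> to \<open>y\<close>, the second one run backwards, close
  up; reversal does not change the edges.\<close>

lemma closed_walk_edges_glue:
  "closed_walk_edges (x # xs @ y # rev ys) = walk_edges (x # xs @ [y]) + walk_edges (x # ys @ [y])"
  using walk_edges_append[of "x # xs" y "rev ys @ [x]"] walk_edges_rev[of "x # ys @ [y]"]
  by (simp add: closed_walk_edges_def)

lemma closed_walk_edges_path:
  "closed_walk_edges (x # xs @ [y]) = add_mset {x, y} (walk_edges (x # xs @ [y]))"
  using closed_walk_edges_glue[of x xs y "[]"] by simp

lemma walk_edges_split:
  "walk_edges (x # xs @ z # ys @ [y]) = walk_edges (x # xs @ [z]) + walk_edges (z # ys @ [y])"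
  using walk_edges_append[of "x # xs" z "ys @ [y]"] by simp

text \<open>The \<open>n\<close> count an edge in the two closed walks, the \<open>m\<close> in the
  cycles kept from them; \<open>p\<close> and \<open>q\<close> are membership in the merged cycles
  and \<open>r\<close> marks their common edge \<open>{a, b}\<close>. Each \<open>m\<close> agrees
  with its \<open>n\<close> modulo 2, so \<open>m1 + m2\<close> has the parity of \<open>p\<close>
  plus \<open>q\<close>; being at most 1, it is the exclusive or of both.\<close>

lemma parity_count:
  fixes m1 m2 n1 n2 :: nat
  assumes "m1 = n1 \<and> m1 \<le> 1 \<or> m1 = 0 \<and> even n1" "m2 = n2 \<and> m2 \<le> 1 \<or> m2 = 0 \<and> even n2"
    and "\<not> (m1 = 1 \<and> m2 = 1)" "n1 + n2 + 2 * of_bool r = of_bool p + of_bool q"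
  shows "m1 + m2 + 2 * of_bool (p \<and> q) = of_bool p + of_bool q"
proof -
  have "n1 + n2 \<le> 2" using assms(4) by (cases p; cases q) auto
  then have "n1 \<in> {0, 1, 2}" "n2 \<in> {0, 1, 2}" by auto
  then show ?thesis using assms by (cases p; cases q; cases r) auto
qed

text \<open>The symmetric difference of the two cycles is a closed walk that can meet itself
  only in \<open>c\<close>, so it splits there into at most two cycles.\<close>

lemma merge_cycles:
  assumes C1: "is_cycle C1" and C2: "is_cycle C2"
    and ab: "{a, b} \<in> uedges C1" "{a, b} \<in> uedges C2"
    and meet: "uverts C1 \<inter> uverts C2 \<subseteq> {a, b, c}"
  shows "\<exists>N. size N \<le> 2 \<and>
    (\<forall>C\<in>#N. is_cycle C \<and> uverts C \<subseteq> uverts C1 \<union> uverts C2 \<and> uedges C \<subseteq> uedges C1 \<union> uedges C2) \<and>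
    (\<forall>e. edge_mult N e + 2 * of_bool (e \<in> uedges C1 \<and> e \<in> uedges C2) =
      of_bool (e \<in> uedges C1) + of_bool (e \<in> uedges C2))"
proof -
  obtain xs where xs: "C1 = list_cycle (a # xs @ [b])" "distinct (a # xs @ [b])" "xs \<noteq> []"
    using is_cycle_imp_list_cycle[OF C1 ab(1)] .
  obtain ys where ys: "C2 = list_cycle (a # ys @ [b])" "distinct (a # ys @ [b])" "ys \<noteq> []"
    using is_cycle_imp_list_cycle[OF C2 ab(2)] .
  have V: "uverts C1 = insert a (insert b (set xs))" "uverts C2 = insert a (insert b (set ys))"
    by (auto simp: xs ys list_cycle_def)
  have int: "set xs \<inter> set ys \<subseteq> {c}" using meet xs(2) ys(2) V by auto
  have len: "length (a # xs @ [b]) \<ge> 3" "length (a # ys @ [b]) \<ge> 3"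
    using xs ys by (auto simp: Suc_le_eq)
  have c1: "of_bool (e \<in> uedges C1) = count (walk_edges (a # xs @ [b])) e + of_bool (e = {a, b})" for e
    using of_bool_mem_list_cycle[OF xs(2) len(1), of e] xs(1) closed_walk_edges_path[of a xs b]
    by simp
  have c2: "of_bool (e \<in> uedges C2) = count (walk_edges (a # ys @ [b])) e + of_bool (e = {a, b})" for e
    using of_bool_mem_list_cycle[OF ys(2) len(2), of e] ys(1) closed_walk_edges_path[of a ys b]
    by simp
  have sub1: "e \<in> uedges C1" if "e \<in># walk_edges (a # xs @ [b])" for e
    using that closed_walk_edges_path[of a xs b] by (simp add: xs list_cycle_def)
  have sub2: "e \<in> uedges C2" if "e \<in># walk_edges (a # ys @ [b])" for e
    using that closed_walk_edges_path[of a ys b] by (simp add: ys list_cycle_def)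
  show ?thesis
  proof (cases "c \<in> set xs \<and> c \<in> set ys")
    \<comment> \<open>The two paths have disjoint interiors here, so together they form a single
      cycle.\<close>
    case False
    define L where "L = a # xs @ b # rev ys"
    have L: "distinct L" "length L \<ge> 3"
      using False int xs ys by (auto simp: L_def Suc_le_eq)
    have cl: "closed_walk_edges L = walk_edges (a # xs @ [b]) + walk_edges (a # ys @ [b])"
      unfolding L_def by (rule closed_walk_edges_glue)
    have "edge_mult {#list_cycle L#} e + 2 * of_bool (e \<in> uedges C1 \<and> e \<in> uedges C2) =
      of_bool (e \<in> uedges C1) + of_bool (e \<in> uedges C2)" for e
    proof -
      have "count (closed_walk_edges L) e + 2 * of_bool (e = {a, b}) =
          of_bool (e \<in> uedges C1) + of_bool (e \<in> uedges C2)"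
        unfolding c1 c2 cl by simp
      moreover have "edge_mult {#list_cycle L#} e = count (closed_walk_edges L) e"
        using of_bool_mem_list_cycle[OF L] by simp
      moreover have "count (closed_walk_edges L) e \<le> 1" using closed_walk_edges_count_le_1[OF L] .
      ultimately show ?thesis by (auto simp: of_bool_def split: if_splits)
    qed
    moreover have "is_cycle (list_cycle L)" using is_cycle_list_cycle[OF L] .
    moreover have "uverts (list_cycle L) \<subseteq> uverts C1 \<union> uverts C2"
      using V by (auto simp: list_cycle_def L_def)
    moreover have "uedges (list_cycle L) \<subseteq> uedges C1 \<union> uedges C2"
      using sub1 sub2 cl by (auto simp: list_cycle_def)
    ultimately show ?thesis by (intro exI[of _ "{#list_cycle L#}"]) simp
  next
    case True
    then obtain x1 x2 y1 y2 where sp: "xs = x1 @ c # x2" "ys = y1 @ c # y2"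
      by (meson split_list)
    \<comment> \<open>Both paths are cut at \<open>c\<close>: the parts between \<open>a\<close> and
      \<open>c\<close> form \<open>L1\<close>, those between \<open>c\<close> and \<open>b\<close>
      form \<open>L2\<close>.\<close>
    define L1 where "L1 = a # x1 @ c # rev y1"
    define L2 where "L2 = c # x2 @ b # rev y2"
    \<comment> \<open>A list of length 2 is an edge of both cycles run back and forth. It cancels in
      the symmetric difference, so it yields no cycle.\<close>
    define loop where "loop L = (if length L \<ge> 3 then {#list_cycle L#} else {#})" for L :: "'a list"
    have d: "distinct L1" "distinct L2" "set L1 \<inter> set L2 \<subseteq> {c}"
      using xs(2) ys(2) int by (auto simp: L1_def L2_def sp)
    have cl1: "closed_walk_edges L1 = walk_edges (a # x1 @ [c]) + walk_edges (a # y1 @ [c])"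
      unfolding L1_def by (rule closed_walk_edges_glue)
    have cl2: "closed_walk_edges L2 = walk_edges (c # x2 @ [b]) + walk_edges (c # y2 @ [b])"
      unfolding L2_def by (rule closed_walk_edges_glue)
    have wx: "walk_edges (a # xs @ [b]) = walk_edges (a # x1 @ [c]) + walk_edges (c # x2 @ [b])"
      using walk_edges_split[of a x1 c x2 b] by (simp add: sp)
    have wy: "walk_edges (a # ys @ [b]) = walk_edges (a # y1 @ [c]) + walk_edges (c # y2 @ [b])"
      using walk_edges_split[of a y1 c y2 b] by (simp add: sp)
    have props: "is_cycle C \<and> uverts C \<subseteq> uverts C1 \<union> uverts C2 \<and> uedges C \<subseteq> uedges C1 \<union> uedges C2"
      if "C \<in># loop L" "L \<in> {L1, L2}" for C L
    proof -
      have C: "C = list_cycle L" "length L \<ge> 3" using that by (auto simp: loop_def split: if_splits)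
      have "distinct L" using that(2) d by blast
      then have "is_cycle C" using C is_cycle_list_cycle by metis
      moreover have "set L \<subseteq> uverts C1 \<union> uverts C2"
        using that(2) unfolding V sp L1_def L2_def by auto
      then have "uverts C \<subseteq> uverts C1 \<union> uverts C2" by (simp add: C list_cycle_def)
      moreover have "uedges C \<subseteq> uedges C1 \<union> uedges C2"
      proof
        fix e assume "e \<in> uedges C"
        then have "e \<in># closed_walk_edges L1 + closed_walk_edges L2"
          using that by (auto simp: C list_cycle_def)
        then show "e \<in> uedges C1 \<union> uedges C2"
          using sub1[of e] sub2[of e] unfolding cl1 cl2 wx wy by auto
      qed
      ultimately show ?thesis by blast
    qed
    have cnt: "edge_mult (loop L) e = count (closed_walk_edges L) e \<and> edge_mult (loop L) e \<le> 1 \<or>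
       edge_mult (loop L) e = 0 \<and> even (count (closed_walk_edges L) e)"
      if LL: "L \<in> {L1, L2}" for L e
    proof (cases "length L \<ge> 3")
      case True
      then show ?thesis
        using of_bool_mem_list_cycle[of L e] closed_walk_edges_count_le_1[of L e] d that
        by (auto simp: loop_def)
    next
      case False
      moreover have "length L \<ge> 2" using LL by (auto simp: L1_def L2_def)
      ultimately have "length L = 2" by simp
      then obtain x y where "L = [x, y]" by (auto simp: length_Suc_conv numeral_2_eq_2)
      then show ?thesis by (auto simp: loop_def closed_walk_edges_def insert_commute)
    qed
    have "edge_mult (loop L1 + loop L2) e + 2 * of_bool (e \<in> uedges C1 \<and> e \<in> uedges C2) =
      of_bool (e \<in> uedges C1) + of_bool (e \<in> uedges C2)" for e
    proof -
      have s: "count (closed_walk_edges L1) e + count (closed_walk_edges L2) e + 2 * of_bool (e = {a, b}) =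
          of_bool (e \<in> uedges C1) + of_bool (e \<in> uedges C2)"
        unfolding c1 c2 cl1 cl2 wx wy by simp
      \<comment> \<open>The two walks have at most the vertex \<open>c\<close> in common, which
        leaves no room for a common edge.\<close>
      have "\<not> (edge_mult (loop L1) e = 1 \<and> edge_mult (loop L2) e = 1)"
      proof
        assume *: "edge_mult (loop L1) e = 1 \<and> edge_mult (loop L2) e = 1"
        then have "e \<in> uedges (list_cycle L1)" "e \<in> uedges (list_cycle L2)"
          "length L1 \<ge> 3" "length L2 \<ge> 3"
          by (auto simp: loop_def of_bool_def split: if_splits)
        then have "e \<subseteq> set L1" "e \<subseteq> set L2" "card e = 2"
          using is_cycle_list_cycle[of L1] is_cycle_list_cycle[of L2] d
          by (auto simp: is_cycle_def simple_graph_def list_cycle_def)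
        then have "e \<subseteq> {c}" "card e = 2" using d(3) by auto
        then show False using card_mono[of "{c}" e] by auto
      qed
      moreover have "edge_mult (loop L1) e = count (closed_walk_edges L1) e \<and> edge_mult (loop L1) e \<le> 1 \<or>
       edge_mult (loop L1) e = 0 \<and> even (count (closed_walk_edges L1) e)"
       "edge_mult (loop L2) e = count (closed_walk_edges L2) e \<and> edge_mult (loop L2) e \<le> 1 \<or>
       edge_mult (loop L2) e = 0 \<and> even (count (closed_walk_edges L2) e)" using cnt by auto
      ultimately show ?thesis unfolding edge_mult_simps using s by (intro parity_count[where r = "e = {a, b}"])
    qed
    moreover have "size (loop L1 + loop L2) \<le> 2" by (simp add: loop_def)
    moreover have "\<forall>C\<in>#loop L1 + loop L2. is_cycle C \<and> uverts C \<subseteq> uverts C1 \<union> uverts C2 \<and>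
        uedges C \<subseteq> uedges C1 \<union> uedges C2"
      using props[of _ L1] props[of _ L2] unfolding set_mset_union by blast
    ultimately show ?thesis by blast
  qed
qed

subsection \<open>Pairing the cycles of two covers\<close>

text \<open>Hall's condition for three pairs: two pairs always satisfy it, and all three violate it
  only when they coincide.\<close>

lemma distinct_representatives:
  assumes "card P = 2" "card Q = 2" "card R = 2" "\<not> (P = Q \<and> Q = R)"
  shows "\<exists>i j k. i \<in> P \<and> j \<in> Q \<and> k \<in> R \<and> i \<noteq> j \<and> j \<noteq> k \<and> i \<noteq> k"
proof -
  obtain p p' where P: "P = {p, p'}" "p \<noteq> p'" using assms(1) by (meson card_2_iff)
  obtain q q' where Q: "Q = {q, q'}" "q \<noteq> q'" using assms(2) by (meson card_2_iff)
  obtain r r' where R: "R = {r, r'}" "r \<noteq> r'" using assms(3) by (meson card_2_iff)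
  show ?thesis
  proof (rule ccontr)
    assume "\<not> ?thesis"
    then have *: "\<And>i j k. i \<in> {p, p'} \<Longrightarrow> j \<in> {q, q'} \<Longrightarrow> k \<in> {r, r'} \<Longrightarrow> i = j \<or> j = k \<or> i = k"
      unfolding P Q R by blast
    have "P = Q \<and> Q = R"
      unfolding P Q R doubleton_eq_iff
      using *[of p q r] *[of p q r'] *[of p q' r] *[of p q' r']
        *[of p' q r] *[of p' q r'] *[of p' q' r] *[of p' q' r'] P(2) Q(2) R(2)
      by auto
    then show False using assms(4) by simp
  qed
qed

text \<open>Think of \<open>P e\<close> and \<open>Q e\<close> as the two cycles through the triangle edge \<open>e\<close> in the covers of
  the two parts. Merging \<open>f e\<close> with \<open>g e\<close> for every \<open>e\<close> then lowers the multiplicity of each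
  triangle edge from 4 to exactly 2; equal pairs are merged once.\<close>

definition compatible_choice ::
  "'e set \<Rightarrow> ('e \<Rightarrow> 'i set) \<Rightarrow> ('e \<Rightarrow> 'j set) \<Rightarrow> ('e \<Rightarrow> 'i) \<Rightarrow> ('e \<Rightarrow> 'j) \<Rightarrow> bool" where
  "compatible_choice E P Q f g \<longleftrightarrow>
     (\<forall>k\<in>E. f k \<in> P k \<and> g k \<in> Q k \<and>
       (\<forall>l\<in>E. (f k = f l \<longleftrightarrow> g k = g l) \<and> (f k \<in> P l \<and> g k \<in> Q l \<longrightarrow> f k = f l)))"

lemma compatible_choice_swap:
  "compatible_choice E P Q f g \<Longrightarrow> compatible_choice E Q P g f"
  unfolding compatible_choice_def by blast

text \<open>The pair \<open>(i, j)\<close> serves \<open>x\<close> and \<open>y\<close> but not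
  \<open>z\<close>, since \<open>i\<close> is not in \<open>P z\<close>. It remains to find for
  \<open>z\<close> a pair of new cycles that serves neither \<open>x\<close> nor
  \<open>y\<close>.\<close>

lemma compatible_choice_exists_no_common:
  assumes d: "x \<noteq> y" "y \<noteq> z" "x \<noteq> z"
    and P: "card (P x) = 2" "card (P y) = 2" "card (P z) = 2"
    and Q: "card (Q x) = 2" "card (Q y) = 2" "card (Q z) = 2" "\<not> (Q x = Q y \<and> Q y = Q z)"
    and ij: "i \<in> P x" "i \<in> P y" "j \<in> Q x" "j \<in> Q y"
    and tr: "P x \<inter> P y \<inter> P z = {}"
  shows "\<exists>f g. compatible_choice {x, y, z} P Q f g"
proof -
  obtain s where s: "P x = {i, s}" using P(1) ij(1) by (metis card_2_iff insertE insert_commute singletonD)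
  obtain t where t: "P y = {i, t}" using P(2) ij(2) by (metis card_2_iff insertE insert_commute singletonD)
  note st = s t
  have iz: "i \<notin> P z" using ij tr by auto
  obtain m n where mn: "Q z = {m, n}" "m \<noteq> n" using Q by (auto simp: card_2_iff)
  obtain u v where uv: "P z = {u, v}" "u \<noteq> v" using P by (auto simp: card_2_iff)
  \<comment> \<open>If \<open>j'\<close> misses \<open>Q x\<close>, only \<open>y\<close> is at
    risk, and an \<open>i'\<close> other than \<open>t\<close> misses \<open>P y\<close>; likewise
    with \<open>x\<close>, \<open>y\<close> and \<open>s\<close>, \<open>t\<close>. If
    \<open>j'\<close> lies in both, then \<open>Q x = Q y\<close>, and \<open>Q z\<close>, being
    different, contains an element outside both.\<close>
  have "\<exists>i' j'. i' \<in> P z \<and> j' \<in> Q z \<and> j' \<noteq> j \<and> \<not> (i' \<in> P x \<and> j' \<in> Q x) \<and> \<not> (i' \<in> P y \<and> j' \<in> Q y)"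
  proof -
    obtain j' where j': "j' \<in> Q z" "j' \<noteq> j" using mn by auto
    consider "j' \<notin> Q x" | "j' \<notin> Q y" | "j' \<in> Q x" "j' \<in> Q y" by blast
    then show ?thesis
    proof cases
      case 1
      obtain i' where "i' \<in> P z" "i' \<noteq> t" using uv by auto
      then show ?thesis using 1 j' st iz by auto
    next
      case 2
      obtain i' where "i' \<in> P z" "i' \<noteq> s" using uv by auto
      then show ?thesis using 2 j' st iz by auto
    next
      case 3
      have two: "A = {j, j'}" if "card A = 2" "j \<in> A" "j' \<in> A" for A
        using that j'(2) by (auto simp: card_2_iff)
      have "Q x = {j, j'}" "Q y = {j, j'}" using two Q ij 3 by auto
      then have "Q z \<noteq> {j, j'}" using Q by auto
      then obtain j'' where "j'' \<in> Q z" "j'' \<noteq> j" "j'' \<noteq> j'" using mn j' by auto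
      then show ?thesis using uv \<open>Q x = _\<close> \<open>Q y = _\<close> by auto
    qed
  qed
  then obtain i' j' where "i' \<in> P z" "j' \<in> Q z" "j' \<noteq> j"
    "\<not> (i' \<in> P x \<and> j' \<in> Q x)" "\<not> (i' \<in> P y \<and> j' \<in> Q y)" by blast
  then have "compatible_choice {x, y, z} P Q ((\<lambda>_. i)(z := i')) ((\<lambda>_. j)(z := j'))"
    unfolding compatible_choice_def using d ij iz by auto
  then show ?thesis by blast
qed

text \<open>If both families have an element common to all three sets, one pair serves all edges.
  Otherwise a family without such an element takes the role of \<open>P\<close> in
  \<open>compatible_choice_exists_no_common\<close>.\<close>

lemma compatible_choice_exists_meet:
  assumes d: "x \<noteq> y" "y \<noteq> z" "x \<noteq> z"
    and P: "card (P x) = 2" "card (P y) = 2" "card (P z) = 2" "\<not> (P x = P y \<and> P y = P z)"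
    and Q: "card (Q x) = 2" "card (Q y) = 2" "card (Q z) = 2" "\<not> (Q x = Q y \<and> Q y = Q z)"
    and ne: "P x \<inter> P y \<noteq> {}" "Q x \<inter> Q y \<noteq> {}"
  shows "\<exists>f g. compatible_choice {x, y, z} P Q f g"
proof -
  obtain i j where ij: "i \<in> P x" "i \<in> P y" "j \<in> Q x" "j \<in> Q y" using ne by auto
  consider "P x \<inter> P y \<inter> P z = {}" | "Q x \<inter> Q y \<inter> Q z = {}"
    | i j where "i \<in> P x \<inter> P y \<inter> P z" "j \<in> Q x \<inter> Q y \<inter> Q z" by blast
  then show ?thesis
  proof cases
    case 1
    then show ?thesis using compatible_choice_exists_no_common[of x y z P Q i j] d P Q ij by blast
  next
    case 2
    then show ?thesis
      using compatible_choice_exists_no_common[of x y z Q P j i] d P Q ij compatible_choice_swap by blast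
  next
    case (3 i j)
    then have "compatible_choice {x, y, z} P Q (\<lambda>_. i) (\<lambda>_. j)"
      by (auto simp: compatible_choice_def)
    then show ?thesis by blast
  qed
qed

text \<open>Either some two edges have meeting sets in both families, or any two edges have disjoint
  sets in at least one. In the latter case a pair chosen for one edge never serves another, so
  distinct representatives of the two families combine freely.\<close>

lemma compatible_choice_exists:
  assumes d: "x \<noteq> y" "y \<noteq> z" "x \<noteq> z"
    and P: "card (P x) = 2" "card (P y) = 2" "card (P z) = 2" "\<not> (P x = P y \<and> P y = P z)"
    and Q: "card (Q x) = 2" "card (Q y) = 2" "card (Q z) = 2" "\<not> (Q x = Q y \<and> Q y = Q z)"
  shows "\<exists>f g. compatible_choice {x, y, z} P Q f g"
proof -
  consider "P x \<inter> P y \<noteq> {}" "Q x \<inter> Q y \<noteq> {}" | "P y \<inter> P z \<noteq> {}" "Q y \<inter> Q z \<noteq> {}"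
    | "P x \<inter> P z \<noteq> {}" "Q x \<inter> Q z \<noteq> {}"
    | "P x \<inter> P y = {} \<or> Q x \<inter> Q y = {}" "P y \<inter> P z = {} \<or> Q y \<inter> Q z = {}"
      "P x \<inter> P z = {} \<or> Q x \<inter> Q z = {}" by blast
  then show ?thesis
  proof cases
    case 1
    then show ?thesis using compatible_choice_exists_meet[of x y z P Q] assms by blast
  next
    case 2
    have "\<exists>f g. compatible_choice {y, z, x} P Q f g"
      by (rule compatible_choice_exists_meet) (use assms 2 in auto)
    moreover have "{y, z, x} = {x, y, z}" by auto
    ultimately show ?thesis by simp
  next
    case 3
    have "\<exists>f g. compatible_choice {x, z, y} P Q f g"
      by (rule compatible_choice_exists_meet) (use assms 3 in auto)
    moreover have "{x, z, y} = {x, y, z}" by auto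
    ultimately show ?thesis by simp
  next
    case 4
    obtain i j k where 1: "i \<in> P x" "j \<in> P y" "k \<in> P z" "i \<noteq> j" "j \<noteq> k" "i \<noteq> k"
      using distinct_representatives[OF P] by blast
    obtain i' j' k' where 2: "i' \<in> Q x" "j' \<in> Q y" "k' \<in> Q z" "i' \<noteq> j'" "j' \<noteq> k'" "i' \<noteq> k'"
      using distinct_representatives[OF Q] by blast
    have "compatible_choice {x, y, z} P Q ((\<lambda>_. i)(y := j, z := k)) ((\<lambda>_. i')(y := j', z := k'))"
      using 1 2 4 d by (auto simp: compatible_choice_def)
    then show ?thesis by blast
  qed
qed

subsection \<open>Double covers of graphs glued along a triangle\<close>

lemma edge_mult_image_mset:
  "finite I \<Longrightarrow> edge_mult (image_mset f (mset_set I)) e = (\<Sum>i\<in>I. of_bool (e \<in> uedges (f i)))"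
  by (induction I rule: finite_induct) auto

lemma edge_mult_sum:
  "finite R \<Longrightarrow> edge_mult (\<Sum>r\<in>R. N r) e = (\<Sum>r\<in>R. edge_mult (N r) e)"
  by (induction R rule: finite_induct) auto

lemma size_sum_mset_le:
  fixes N :: "'r \<Rightarrow> 'b multiset"
  shows "finite R \<Longrightarrow> (\<And>r. r \<in> R \<Longrightarrow> size (N r) \<le> k) \<Longrightarrow> size (\<Sum>r\<in>R. N r) \<le> k * card R"
  by (induction R rule: finite_induct) (auto simp: add_mono)

text \<open>A cover may contain the same cycle twice. Indices tell the copies apart, so the cycles
  through an edge form a genuine 2-element set.\<close>

lemma mset_indexed:
  obtains I :: "nat set" and f where "finite I" "M = image_mset f (mset_set I)"
proof -
  obtain L where L: "mset L = M" using ex_mset by blast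
  have "M = mset (map ((!) L) [0..<length L])" by (simp add: map_nth L)
  also have "\<dots> = image_mset ((!) L) (mset_set {0..<length L})" by (simp only: mset_map mset_upt)
  finally show ?thesis using that[of "{0..<length L}" "(!) L"] by simp
qed

lemma cycle_double_cover_iff:
  "cycle_double_cover G M \<longleftrightarrow>
    (\<forall>C\<in>#M. is_cycle C \<and> subgraph C G) \<and> (\<forall>e\<in>uedges G. edge_mult M e = 2)"
  by (simp add: cycle_double_cover_def edge_mult_def)

text \<open>All that the combinatorial part sees of the plane: two graphs whose union has the edges
  of \<open>G\<close> and which overlap in the triangle \<open>a\<close>, \<open>b\<close>,
  \<open>c\<close>.\<close>

locale triangle_sum =
  fixes G G1 G2 :: "'a ugraph" and a b c :: 'a
  assumes sub: "subgraph G1 G" "subgraph G2 G" and edges: "uedges G = uedges G1 \<union> uedges G2"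
    and distinct: "a \<noteq> b" "b \<noteq> c" "a \<noteq> c"
    and verts_meet: "uverts G1 \<inter> uverts G2 \<subseteq> {a, b, c}"
    and edges_meet: "uedges G1 \<inter> uedges G2 = {{a, b}, {b, c}, {a, c}}"
begin

lemma swap: "triangle_sum G G2 G1 a b c"
  using sub edges distinct verts_meet edges_meet by unfold_locales (simp_all add: Un_commute Int_commute)

definition triangle_edges where "triangle_edges = {{a, b}, {b, c}, {a, c}}"

text \<open>Each cycle in \<open>P\<close> contains all three triangle edges, hence the triangle as
  a subgraph, and so equals it by \<open>is_cycle_subgraph_eq\<close>. Without these copies the
  triangle edges are left to \<open>M2\<close>.\<close>

lemma cover_of_doubled_triangle:
  assumes M1: "cycle_double_cover G1 M1" and M2: "cycle_double_cover G2 M2"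
    and I: "finite I" "M1 = image_mset f (mset_set I)"
    and P: "\<And>e. e \<in> triangle_edges \<Longrightarrow> {i \<in> I. e \<in> uedges (f i)} = P"
  shows "\<exists>M. cycle_double_cover G M \<and> size M \<le> size M1 + size M2"
proof -
  define M where "M = image_mset f (mset_set (I - P)) + M2"
  have cyc1: "is_cycle (f i)" "subgraph (f i) G1" if "i \<in> I" for i
    using M1 I that by (auto simp: cycle_double_cover_def)
  have PI: "P \<subseteq> I" using P[of "{a, b}"] by (auto simp: triangle_edges_def)
  have tri: "uedges (f i) = triangle_edges" if "i \<in> P" for i
  proof -
    have i: "i \<in> I" using that PI by auto
    have Ei: "triangle_edges \<subseteq> uedges (f i)" using P that by auto
    have "uedges (list_cycle [a, b, c]) = triangle_edges"
      by (auto simp: list_cycle_def closed_walk_edges_def triangle_edges_def insert_commute)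
    moreover have "{a, b, c} \<subseteq> uverts (f i)"
      using Ei cyc1(1)[OF i] by (auto simp: triangle_edges_def is_cycle_def simple_graph_def)
    ultimately have "subgraph (list_cycle [a, b, c]) (f i)"
      using Ei by (simp add: subgraph_def list_cycle_def)
    moreover have "is_cycle (list_cycle [a, b, c])"
      using distinct by (intro is_cycle_list_cycle) auto
    ultimately have "list_cycle [a, b, c] = f i" using is_cycle_subgraph_eq cyc1(1)[OF i] by blast
    then show ?thesis using \<open>uedges (list_cycle [a, b, c]) = triangle_edges\<close> by simp
  qed
  \<comment> \<open>Dropping \<open>P\<close> affects triangle edges only and takes away their whole
    multiplicity in \<open>M1\<close>.\<close>
  have mult1: "edge_mult (image_mset f (mset_set (I - P))) e = (if e \<in> uedges G1 \<and> e \<notin> triangle_edges then 2 else 0)" for e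
  proof (cases "e \<in> uedges G1 \<and> e \<notin> triangle_edges")
    case True
    have "edge_mult M1 e = (\<Sum>i\<in>I. of_bool (e \<in> uedges (f i)))"
      unfolding I(2) by (rule edge_mult_image_mset[OF I(1)])
    also have "\<dots> = (\<Sum>i\<in>I - P. of_bool (e \<in> uedges (f i)))"
      using I(1) tri True by (intro sum.mono_neutral_right) auto
    finally show ?thesis using True M1 I(1) by (simp add: edge_mult_image_mset cycle_double_cover_iff)
  next
    case False
    have "e \<notin> uedges (f i)" if "i \<in> I - P" for i
      using False P[of e] cyc1(2)[of i] that by (auto simp: subgraph_def)
    then show ?thesis using False I(1) by (simp add: edge_mult_image_mset)
  qed
  have mult2: "edge_mult M2 e = 0" if "e \<notin> uedges G2" for e
  proof -
    have "\<forall>C\<in>#M2. e \<notin> uedges C" using M2 that by (auto simp: cycle_double_cover_def subgraph_def)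
    then have "{#C \<in># M2. e \<in> uedges C#} = {#}" by simp
    then show ?thesis by (simp add: edge_mult_def)
  qed
  have "edge_mult M e = 2" if "e \<in> uedges G" for e
  proof -
    have E: "uedges G1 \<inter> uedges G2 = triangle_edges" using edges_meet by (simp add: triangle_edges_def)
    show ?thesis
    proof (cases "e \<in> uedges G2")
      case True
      then have "\<not> (e \<in> uedges G1 \<and> e \<notin> triangle_edges)" using E by blast
      then show ?thesis using True M2 mult1[of e] by (simp add: M_def cycle_double_cover_iff)
    next
      case False
      then have "e \<in> uedges G1 \<and> e \<notin> triangle_edges" using E edges that by blast
      then show ?thesis using False mult1[of e] mult2[of e] by (simp add: M_def)
    qed
  qed
  moreover have "is_cycle C \<and> subgraph C G" if "C \<in># M" for C
  proof -
    have "is_cycle C" "subgraph C G1 \<or> subgraph C G2"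
      using that I(1) cyc1 M2 by (auto simp: M_def cycle_double_cover_def)
    then show ?thesis using sub by (auto simp: subgraph_def)
  qed
  moreover have "size M \<le> size M1 + size M2"
    using I by (simp add: M_def card_mono)
  ultimately show ?thesis by (auto simp: cycle_double_cover_iff)
qed

text \<open>Any of the three triangle edges can take the role of \<open>{a, b}\<close> in
  \<open>merge_cycles\<close>; the third triangle vertex is then the possible crossing
  point.\<close>

lemma merge_cycles_of_parts:
  assumes "is_cycle C1" "subgraph C1 G1" "is_cycle C2" "subgraph C2 G2"
    and "e \<in> triangle_edges" "e \<in> uedges C1" "e \<in> uedges C2"
  shows "\<exists>N. size N \<le> 2 \<and> (\<forall>C\<in>#N. is_cycle C \<and> subgraph C G) \<and>
    (\<forall>e. edge_mult N e + 2 * of_bool (e \<in> uedges C1 \<and> e \<in> uedges C2) =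
      of_bool (e \<in> uedges C1) + of_bool (e \<in> uedges C2))"
proof -
  have "uverts C1 \<inter> uverts C2 \<subseteq> {a, b, c}"
    using assms(2,4) verts_meet by (auto simp: subgraph_def)
  then have "\<exists>x y z. e = {x, y} \<and> uverts C1 \<inter> uverts C2 \<subseteq> {x, y, z}"
    using assms(5) unfolding triangle_edges_def by (auto simp: insert_commute)
  then obtain x y z where xyz: "e = {x, y}" "uverts C1 \<inter> uverts C2 \<subseteq> {x, y, z}" by blast

  obtain N where N: "size N \<le> 2"
    "\<forall>C\<in>#N. is_cycle C \<and> uverts C \<subseteq> uverts C1 \<union> uverts C2 \<and> uedges C \<subseteq> uedges C1 \<union> uedges C2"
    "\<forall>e. edge_mult N e + 2 * of_bool (e \<in> uedges C1 \<and> e \<in> uedges C2) =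
      of_bool (e \<in> uedges C1) + of_bool (e \<in> uedges C2)"
    using merge_cycles[OF assms(1,3) assms(6,7)[unfolded xyz(1)] xyz(2)] by (elim exE conjE)
  have "subgraph C G" if "C \<in># N" for C
    using bspec[OF N(2) that] assms(2,4) sub unfolding subgraph_def by (meson Un_least subset_trans)
  then have "\<forall>C\<in>#N. is_cycle C \<and> subgraph C G" using N(2) by blast
  then show ?thesis using N(1,3) by (intro exI[of _ N] conjI)
qed

lemma cover_of_compatible_choice:
  assumes M1: "cycle_double_cover G1 M1" and M2: "cycle_double_cover G2 M2"
    and I: "finite I" "M1 = image_mset f (mset_set I)"
    and J: "finite J" "M2 = image_mset g (mset_set J)"
    and cc: "compatible_choice triangle_edges (\<lambda>e. {i \<in> I. e \<in> uedges (f i)}) (\<lambda>e. {j \<in> J. e \<in> uedges (g j)}) u v"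
  shows "\<exists>M. cycle_double_cover G M \<and> size M \<le> size M1 + size M2"
proof -
  have cyc1: "is_cycle (f i)" "subgraph (f i) G1" if "i \<in> I" for i
    using M1 I that by (auto simp: cycle_double_cover_def)
  have cyc2: "is_cycle (g j)" "subgraph (g j) G2" if "j \<in> J" for j
    using M2 J that by (auto simp: cycle_double_cover_def)
  \<comment> \<open>As an image, \<open>R\<close> contains a pair once even if it was chosen for
    several edges.\<close>
  define R where "R = (\<lambda>k. (u k, v k)) ` triangle_edges"
  have cc1: "u k \<in> I" "k \<in> uedges (f (u k))" "v k \<in> J" "k \<in> uedges (g (v k))" if "k \<in> triangle_edges" for k
    using bspec[OF iffD1[OF compatible_choice_def cc] that] by simp_all
  have cc2: "u k = u l \<longleftrightarrow> v k = v l" if "k \<in> triangle_edges" "l \<in> triangle_edges" for k l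
    using bspec[OF iffD1[OF compatible_choice_def cc] that(1)] that(2) by blast
  have cc3: "u k = u l" if "k \<in> triangle_edges" "l \<in> triangle_edges" "l \<in> uedges (f (u k))" "l \<in> uedges (g (v k))" for k l
  proof -
    have "u k \<in> {i \<in> I. l \<in> uedges (f i)} \<and> v k \<in> {j \<in> J. l \<in> uedges (g j)} \<longrightarrow> u k = u l"
      using bspec[OF iffD1[OF compatible_choice_def cc] that(1)] that(2) by blast
    then show ?thesis using that(3,4) cc1[OF that(1)] by blast
  qed
  have finR: "finite R" by (simp add: R_def triangle_edges_def)
  \<comment> \<open>No cycle of either cover belongs to two different pairs of \<open>R\<close>, so
    each is consumed at most once.\<close>
  have inj: "inj_on fst R" "inj_on snd R" using cc2 by (auto simp: inj_on_def R_def)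
  have RI: "fst ` R \<subseteq> I" "snd ` R \<subseteq> J" using cc1 by (auto simp: R_def)
  define merged where "merged r N \<longleftrightarrow> size N \<le> 2 \<and> (\<forall>C\<in>#N. is_cycle C \<and> subgraph C G) \<and>
    (\<forall>e. edge_mult N e + 2 * of_bool (e \<in> uedges (f (fst r)) \<and> e \<in> uedges (g (snd r))) =
      of_bool (e \<in> uedges (f (fst r))) + of_bool (e \<in> uedges (g (snd r))))" for r N
  have "\<forall>r\<in>R. \<exists>N. merged r N"
  proof
    fix r assume r: "r \<in> R"
    obtain k where k: "k \<in> triangle_edges" "r = (u k, v k)" using r by (auto simp: R_def)
    show "\<exists>N. merged r N"
      unfolding merged_def k(2) fst_conv snd_conv
      by (rule merge_cycles_of_parts[OF cyc1[OF cc1(1)[OF k(1)]] cyc2[OF cc1(3)[OF k(1)]] k(1)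
            cc1(2)[OF k(1)] cc1(4)[OF k(1)]])
  qed
  then obtain N where "\<forall>r\<in>R. merged r (N r)" by (rule bchoice[THEN exE])
  note mr = bspec[OF this, unfolded merged_def]
  note N = mr[THEN conjunct1] mr[THEN conjunct2, THEN conjunct1, THEN bspec]
    mr[THEN conjunct2, THEN conjunct2, THEN spec]
  define M where "M = image_mset f (mset_set (I - fst ` R)) + image_mset g (mset_set (J - snd ` R))
    + (\<Sum>r\<in>R. N r)"
  \<comment> \<open>A triangle edge is common to the cycles of exactly one pair, any other edge to
    none. The merges thus subtract 2 on triangle edges and nothing elsewhere.\<close>
  have common: "(\<Sum>r\<in>R. of_bool (e \<in> uedges (f (fst r)) \<and> e \<in> uedges (g (snd r)))) = (of_bool (e \<in> triangle_edges) :: nat)" for e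
  proof (cases "e \<in> triangle_edges")
    case True
    have "{r \<in> R. e \<in> uedges (f (fst r)) \<and> e \<in> uedges (g (snd r))} = {(u e, v e)}"
    proof (intro equalityI subsetI)
      fix r assume r: "r \<in> {r \<in> R. e \<in> uedges (f (fst r)) \<and> e \<in> uedges (g (snd r))}"
      then obtain k where k: "k \<in> triangle_edges" "r = (u k, v k)" unfolding R_def by blast
      then have "u k = u e" using cc3[OF k(1) True] r by simp
      then show "r \<in> {(u e, v e)}" using cc2[OF k(1) True] k(2) by simp
    next
      fix r assume "r \<in> {(u e, v e)}"
      then show "r \<in> {r \<in> R. e \<in> uedges (f (fst r)) \<and> e \<in> uedges (g (snd r))}"
        using True cc1(2,4)[OF True] by (simp add: R_def)
    qed
    then have "card (R \<inter> {r. e \<in> uedges (f (fst r)) \<and> e \<in> uedges (g (snd r))}) = 1"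
      by (simp add: Int_def)
    then show ?thesis using True finR by (simp only: sum_of_bool_eq of_bool_eq of_nat_id)
  next
    case False
    have "\<not> (e \<in> uedges (f (fst r)) \<and> e \<in> uedges (g (snd r)))" if "r \<in> R" for r
      using False cyc1(2)[of "fst r"] cyc2(2)[of "snd r"] RI that edges_meet
      unfolding subgraph_def triangle_edges_def by blast
    then have "(\<Sum>r\<in>R. of_bool (e \<in> uedges (f (fst r)) \<and> e \<in> uedges (g (snd r)))) = (0 :: nat)"
      by (intro sum.neutral) simp
    then show ?thesis using False by simp
  qed
  have mult: "edge_mult M e + 2 * of_bool (e \<in> triangle_edges) = edge_mult M1 e + edge_mult M2 e" for e
  proof -
    let ?x = "\<lambda>i. of_bool (e \<in> uedges (f i)) :: nat" and ?y = "\<lambda>j. of_bool (e \<in> uedges (g j)) :: nat"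
    have "(\<Sum>r\<in>R. edge_mult (N r) e) + 2 * of_bool (e \<in> triangle_edges)
      = (\<Sum>r\<in>R. edge_mult (N r) e + 2 * of_bool (e \<in> uedges (f (fst r)) \<and> e \<in> uedges (g (snd r))))"
      unfolding common[symmetric] by (simp add: sum.distrib sum_distrib_left)
    also have "\<dots> = (\<Sum>r\<in>R. ?x (fst r) + ?y (snd r))" using N(3) by (intro sum.cong) auto
    also have "\<dots> = sum ?x (fst ` R) + sum ?y (snd ` R)"
      by (simp add: sum.distrib sum.reindex[OF inj(1)] sum.reindex[OF inj(2)])
    finally have "edge_mult M e + 2 * of_bool (e \<in> triangle_edges) =
        (sum ?x (I - fst ` R) + sum ?x (fst ` R)) + (sum ?y (J - snd ` R) + sum ?y (snd ` R))"
      using I(1) J(1) finR by (simp add: M_def edge_mult_image_mset edge_mult_sum)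
    also have "\<dots> = sum ?x I + sum ?y J"
      using sum.subset_diff[OF RI(1) I(1), of ?x] sum.subset_diff[OF RI(2) J(1), of ?y] by simp
    finally show ?thesis using I J by (simp add: edge_mult_image_mset)
  qed
  have m1: "edge_mult M1 e = (if e \<in> uedges G1 then 2 else 0)" for e
    using M1 cyc1(2) I by (auto simp: cycle_double_cover_iff edge_mult_image_mset subgraph_def)
  have m2: "edge_mult M2 e = (if e \<in> uedges G2 then 2 else 0)" for e
    using M2 cyc2(2) J by (auto simp: cycle_double_cover_iff edge_mult_image_mset subgraph_def)
  have "edge_mult M e = 2" if "e \<in> uedges G" for e
    using that mult[of e] m1[of e] m2[of e] edges edges_meet
    by (cases "e \<in> triangle_edges") (auto simp: triangle_edges_def split: if_splits)
  moreover have "is_cycle C \<and> subgraph C G" if "C \<in># M" for C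
  proof -
    have "(\<exists>i\<in>I. C = f i) \<or> (\<exists>j\<in>J. C = g j) \<or> (\<exists>r\<in>R. C \<in># N r)"
      using that I(1) J(1) finR by (auto simp: M_def set_mset_sum)
    then show ?thesis using cyc1 cyc2 N(2) sub unfolding subgraph_def by blast
  qed
  \<comment> \<open>Every pair takes one cycle from each cover and returns at most two.\<close>
  moreover have "size M \<le> size M1 + size M2"
  proof -
    have "card R \<le> card I" "card R \<le> card J"
      using RI I(1) J(1) inj by (metis card_image card_mono)+
    moreover have "size (\<Sum>r\<in>R. N r) \<le> 2 * card R" using size_sum_mset_le[OF finR] N(1) by blast
    moreover have "card (I - fst ` R) = card I - card R" "card (J - snd ` R) = card J - card R"
      using RI I(1) J(1) inj finR by (simp_all add: card_Diff_subset card_image)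
    ultimately show ?thesis using I J by (simp add: M_def)
  qed
  ultimately show ?thesis by (auto simp: cycle_double_cover_iff)
qed

lemma cover_exists:
  assumes M1: "cycle_double_cover G1 M1" and M2: "cycle_double_cover G2 M2"
  shows "\<exists>M. cycle_double_cover G M \<and> size M \<le> size M1 + size M2"
proof -
  obtain I :: "nat set" and f where I: "finite I" "M1 = image_mset f (mset_set I)"
    using mset_indexed by blast
  obtain J :: "nat set" and g where J: "finite J" "M2 = image_mset g (mset_set J)"
    using mset_indexed by blast
  define P where "P e = {i \<in> I. e \<in> uedges (f i)}" for e
  define Q where "Q e = {j \<in> J. e \<in> uedges (g j)}" for e
  have E: "triangle_edges \<subseteq> uedges G1" "triangle_edges \<subseteq> uedges G2" using edges_meet by (auto simp: triangle_edges_def)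
  have cP: "card (P e) = 2" if "e \<in> triangle_edges" for e
  proof -
    have "edge_mult M1 e = 2" using M1 E that by (auto simp: cycle_double_cover_iff)
    then show ?thesis using I by (simp add: edge_mult_image_mset P_def Int_def)
  qed
  have cQ: "card (Q e) = 2" if "e \<in> triangle_edges" for e
  proof -
    have "edge_mult M2 e = 2" using M2 E that by (auto simp: cycle_double_cover_iff)
    then show ?thesis using J by (simp add: edge_mult_image_mset Q_def Int_def)
  qed
  let ?same = "\<lambda>P. P {a, b} = P {b, c} \<and> P {b, c} = P {a, c}"
  consider "?same P" | "?same Q" | "\<not> ?same P" "\<not> ?same Q" by blast
  then show ?thesis
  proof cases
    case 1
    show ?thesis
      by (rule cover_of_doubled_triangle[OF M1 M2 I, of "P {a, b}"]) (use 1 in \<open>auto simp: triangle_edges_def P_def\<close>)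
  next
    case 2
    interpret sw: triangle_sum G G2 G1 a b c by (rule swap)
    have "\<exists>M. cycle_double_cover G M \<and> size M \<le> size M2 + size M1"
      by (rule sw.cover_of_doubled_triangle[OF M2 M1 J, of "Q {a, b}"]) (use 2 in \<open>auto simp: sw.triangle_edges_def Q_def\<close>)
    then show ?thesis by (simp add: add.commute)
  next
    case 3
    have "\<exists>u v. compatible_choice triangle_edges P Q u v"
      unfolding triangle_edges_def
      by (rule compatible_choice_exists)
        (use 3 cP cQ distinct in \<open>auto simp: triangle_edges_def doubleton_eq_iff\<close>)
    then show ?thesis
      using cover_of_compatible_choice[OF M1 M2 I J] unfolding P_def Q_def by blast
  qed
qed

lemma cdc_number_le: "cdc_number G \<le> cdc_number G1 + cdc_number G2"
proof -
  \<comment> \<open>The order on \<open>enat\<close> is a well-order, so the infimum of a nonempty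
    set is attained.\<close>
  have att: "\<exists>M. cycle_double_cover H M \<and> cdc_number H = enat (size M)" if "cdc_number H \<noteq> \<infinity>" for H :: "'a ugraph"
  proof -
    let ?A = "(\<lambda>M. enat (size M)) ` {M. cycle_double_cover H M}"
    have "?A \<noteq> {}"
    proof
      assume "?A = {}"
      then have "cdc_number H = Inf {}" unfolding cdc_number_def by (rule arg_cong)
      then show False using that by (simp add: top_enat_def)
    qed
    then obtain x where x: "x \<in> ?A" by blast
    have "Inf ?A \<in> ?A" using wellorder_InfI[OF x] .
    then show ?thesis by (auto simp: cdc_number_def)
  qed
  show ?thesis
  proof (cases "cdc_number G1 = \<infinity> \<or> cdc_number G2 = \<infinity>")
    case False
    then obtain M1 where M1: "cycle_double_cover G1 M1" "cdc_number G1 = enat (size M1)"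
      using att by blast
    obtain M2 where M2: "cycle_double_cover G2 M2" "cdc_number G2 = enat (size M2)"
      using False att by blast
    note M = M1 M2
    obtain M' where "cycle_double_cover G M'" "size M' \<le> size M1 + size M2"
      using cover_exists M by blast
    then have "cdc_number G \<le> enat (size M')" by (auto simp: cdc_number_def intro: INF_lower)
    also have "\<dots> \<le> enat (size M1 + size M2)" using \<open>size M' \<le> _\<close> by simp
    finally show ?thesis using M by simp
  qed auto
qed

end

subsection \<open>Triangles in plane graphs\<close>

text \<open>The interior of an arc is dense in it, so a closed set containing the interior also
  contains the ends.\<close>

lemma arc_subset_closed:
  assumes "arc g" "closed K" "path_image g - {pathstart g, pathfinish g} \<subseteq> K"
  shows "path_image g \<subseteq> K"
proof -
  have "g ` {0<..<1} \<subseteq> K"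
    using assms(3) simple_path_endless[OF arc_imp_simple_path[OF assms(1)]] by simp
  moreover have "continuous_on (closure {0<..<1}) g"
    using arc_imp_path[OF assms(1)] by (simp add: path_def)
  ultimately have "g ` closure {0<..<1} \<subseteq> K" using assms(2) by (intro image_closure_subset)
  then show ?thesis by (simp add: path_image_def)
qed

locale plane =
  fixes T :: plane_graph
  assumes plane: "is_plane_graph T"
begin

lemma finite_verts: "finite (pverts T)" and finite_arcs: "finite (parcs T)"
  and arcs_inj: "inj_on (\<lambda>e. e \<inter> pverts T) (parcs T)"
  using plane by (auto simp: is_plane_graph_def)

lemma arcs_meet: "e \<in> parcs T \<Longrightarrow> f \<in> parcs T \<Longrightarrow> p \<in> e \<Longrightarrow> p \<in> f \<Longrightarrow> p \<notin> pverts T \<Longrightarrow> e = f"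
  using plane by (auto simp: is_plane_graph_def)

lemma arcs_Int_subset:
  "e \<in> parcs T \<Longrightarrow> f \<in> parcs T \<Longrightarrow> e \<noteq> f \<Longrightarrow> e \<inter> f \<subseteq> (e \<inter> pverts T) \<inter> (f \<inter> pverts T)"
  using arcs_meet by blast

lemma arc_param:
  assumes "e \<in> parcs T"
  obtains g where "arc g" "path_image g = e" "e \<inter> pverts T = {pathstart g, pathfinish g}"
proof -
  have "\<forall>e\<in>parcs T. \<exists>g. arc g \<and> path_image g = e \<and> e \<inter> pverts T = {pathstart g, pathfinish g}"
    using plane by (simp add: is_plane_graph_def)
  from bspec[OF this assms] show ?thesis using that by (elim exE conjE)
qed

lemma arc_oriented:
  assumes "e \<in> parcs T" "e \<inter> pverts T = {x, y}"
  obtains g where "arc g" "path_image g = e" "pathstart g = x" "pathfinish g = y"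
proof -
  obtain g where g: "arc g" "path_image g = e" "e \<inter> pverts T = {pathstart g, pathfinish g}"
    using arc_param[OF assms(1)] .
  then consider "pathstart g = x" "pathfinish g = y" | "pathstart g = y" "pathfinish g = x"
    using assms(2) by (auto simp: doubleton_eq_iff)
  then show ?thesis
  proof cases
    case 1
    then show ?thesis using that g by blast
  next
    case 2
    then show ?thesis using that[of "reversepath g"] g by (simp add: arc_reversepath)
  qed
qed

lemma card_ends: "e \<in> parcs T \<Longrightarrow> card (e \<inter> pverts T) = 2"
  by (erule arc_param) (use arc_distinct_ends in \<open>fastforce simp: card_2_iff\<close>)

lemma open_arc_connected: "e \<in> parcs T \<Longrightarrow> connected (e - pverts T)"
  and open_arc_nonempty: "e \<in> parcs T \<Longrightarrow> e - pverts T \<noteq> {}"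
  and open_arc_dense: "e \<in> parcs T \<Longrightarrow> closed K \<Longrightarrow> e - pverts T \<subseteq> K \<Longrightarrow> e \<subseteq> K"
  and closed_arc: "e \<in> parcs T \<Longrightarrow> closed e"
proof -
  assume e: "e \<in> parcs T"
  obtain g where g: "arc g" "path_image g = e" "e \<inter> pverts T = {pathstart g, pathfinish g}"
    using arc_param[OF e] .
  have eq: "e - pverts T = path_image g - {pathstart g, pathfinish g}" using g by blast
  show "connected (e - pverts T)" "e - pverts T \<noteq> {}"
    unfolding eq using g(1) connected_simple_path_endless nonempty_simple_path_endless
      arc_imp_simple_path by blast+
  show "closed e" using g closed_arc_image by blast
  show "e \<subseteq> K" if "closed K" "e - pverts T \<subseteq> K"
    using arc_subset_closed[OF g(1) that(1)] that(2) eq g(2) by simp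
qed

lemma closed_point_set:
  assumes "pverts S \<subseteq> pverts T" "parcs S \<subseteq> parcs T" shows "closed (point_set S)"
  unfolding point_set_def using assms closed_arc finite_verts finite_arcs
  by (intro closed_Un closed_Union finite_imp_closed) (auto intro: finite_subset)

text \<open>On three vertices, degree 2 forces all three edges. Since an arc is determined by its
  ends, there is exactly one arc for each.\<close>

lemma triangle_structure:
  assumes "triangle_of S T"
  obtains a b c e1 e2 e3 where "a \<noteq> b" "b \<noteq> c" "a \<noteq> c"
    "pverts S = {a, b, c}" "parcs S = {e1, e2, e3}" "{e1, e2, e3} \<subseteq> parcs T"
    "e1 \<inter> pverts T = {a, b}" "e2 \<inter> pverts T = {b, c}" "e3 \<inter> pverts T = {a, c}"
proof -
  have S: "pverts S \<subseteq> pverts T" "parcs S \<subseteq> parcs T" "is_cycle (underlying S)" "card (pverts S) = 3"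
    using assms by (auto simp: triangle_of_def)
  obtain a b c where abc: "pverts S = {a, b, c}" "a \<noteq> b" "b \<noteq> c" "a \<noteq> c"
    using S(4) by (metis card_3_iff)
  let ?E = "uedges (underlying S)"
  have E2: "e \<subseteq> {a, b, c} \<and> card e = 2" if "e \<in> ?E" for e
    using S(3) that abc by (auto simp: is_cycle_def simple_graph_def underlying_def)
  have E3: "e = {a, b} \<or> e = {b, c} \<or> e = {a, c}" if e: "e \<in> ?E" for e
  proof -
    obtain x y where "e = {x, y}" "x \<noteq> y" using E2[OF e] by (meson card_2_iff)
    then show ?thesis using E2[OF e] by auto
  qed
  have deg: "card {e \<in> ?E. v \<in> e} = 2" if "v \<in> {a, b, c}" for v
    using S(3) that abc(1) by (auto simp: is_cycle_def udegree_def underlying_def)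
  have small: "{x, y} \<in> ?E \<and> {x, z} \<in> ?E" if "{x, y, z} = {a, b, c}" "x \<noteq> y" "y \<noteq> z" "x \<noteq> z" for x y z
  proof -
    have "{e \<in> ?E. x \<in> e} \<subseteq> {{x, y}, {x, z}}"
    proof
      fix e assume "e \<in> {e \<in> ?E. x \<in> e}"
      then have e: "e \<in> ?E" "x \<in> e" by auto
      then obtain p q where pq: "e = {p, q}" "p \<noteq> q" using E2 by (meson card_2_iff)
      moreover have "p \<in> {x, y, z}" "q \<in> {x, y, z}" using E2[OF e(1)] pq that(1) by auto
      ultimately show "e \<in> {{x, y}, {x, z}}" using e(2) by auto
    qed
    moreover have "card {e \<in> ?E. x \<in> e} = 2" using deg that(1) by blast
    moreover have "card {{x, y}, {x, z}} = 2" using that by (auto simp: doubleton_eq_iff)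
    ultimately have "{e \<in> ?E. x \<in> e} = {{x, y}, {x, z}}" by (intro card_subset_eq) auto
    then show ?thesis by blast
  qed
  have "{a, b} \<in> ?E" "{a, c} \<in> ?E" using small[of a b c] abc by auto
  moreover have "{b, c} \<in> ?E" using small[of b c a] abc by auto
  ultimately obtain e1 e2 e3 where e: "e1 \<in> parcs S" "e2 \<in> parcs S" "e3 \<in> parcs S"
    "e1 \<inter> pverts S = {a, b}" "e2 \<inter> pverts S = {b, c}" "e3 \<inter> pverts S = {a, c}"
    unfolding underlying_def by auto
  \<comment> \<open>An arc of \<open>S\<close> has two ends among \<open>pverts S\<close> and two
    among \<open>pverts T\<close>, so no end in \<open>T\<close> lies outside
    \<open>S\<close>.\<close>
  have ends: "e \<inter> pverts T = e \<inter> pverts S" if "e \<in> parcs S" for e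
  proof -
    have "e \<inter> pverts S \<in> ?E" using that by (simp add: underlying_def)
    then have "card (e \<inter> pverts S) = 2" using E2 by blast
    moreover have "card (e \<inter> pverts T) = 2" using card_ends S(2) that by blast
    moreover have "e \<inter> pverts S \<subseteq> e \<inter> pverts T" using S(1) by blast
    ultimately show ?thesis using finite_verts by (metis card_subset_eq finite_Int)
  qed
  have "f \<in> {e1, e2, e3}" if "f \<in> parcs S" for f
  proof -
    have "f \<inter> pverts S \<in> ?E" using that by (simp add: underlying_def)
    then have "f \<inter> pverts T = e1 \<inter> pverts T \<or> f \<inter> pverts T = e2 \<inter> pverts T \<or> f \<inter> pverts T = e3 \<inter> pverts T"
      using E3[of "f \<inter> pverts S"] e ends that by auto
    moreover have "f = e" if "f \<inter> pverts T = e \<inter> pverts T" "e \<in> parcs S" for e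
      using inj_onD[OF arcs_inj that(1)] that(2) \<open>f \<in> parcs S\<close> S(2) by blast
    ultimately show ?thesis using e(1-3) by blast
  qed
  then have "parcs S = {e1, e2, e3}" using e by blast
  then show ?thesis using abc e ends S(2) by (intro that[of a b c e1 e2 e3]) simp_all
qed

lemma triangleI:
  assumes "a \<noteq> b" "b \<noteq> c" "a \<noteq> c" "{e1, e2, e3} \<subseteq> parcs T"
    "e1 \<inter> pverts T = {a, b}" "e2 \<inter> pverts T = {b, c}" "e3 \<inter> pverts T = {a, c}"
  shows "triangle_of \<lparr>pverts = {a, b, c}, parcs = {e1, e2, e3}\<rparr> T"
proof -
  have sub: "{a, b, c} \<subseteq> pverts T" using assms by blast
  have "e1 \<inter> {a, b, c} = {a, b}" "e2 \<inter> {a, b, c} = {b, c}" "e3 \<inter> {a, b, c} = {a, c}"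
    using assms sub by blast+
  then have "underlying \<lparr>pverts = {a, b, c}, parcs = {e1, e2, e3}\<rparr> = list_cycle [a, b, c]"
    by (auto simp: underlying_def list_cycle_def closed_walk_edges_def insert_commute)
  moreover have "is_cycle (list_cycle [a, b, c])" using assms by (intro is_cycle_list_cycle) auto
  ultimately show ?thesis using assms sub by (auto simp: triangle_of_def)
qed

lemma triangle_point_set_verts:
  assumes "triangle_of S T" shows "point_set S \<inter> pverts T = pverts S"
proof -
  obtain a b c e1 e2 e3 where S: "pverts S = {a, b, c}" "parcs S = {e1, e2, e3}"
    "e1 \<inter> pverts T = {a, b}" "e2 \<inter> pverts T = {b, c}" "e3 \<inter> pverts T = {a, c}"
    using triangle_structure[OF assms] .
  have "point_set S \<inter> pverts T =
      (pverts S \<inter> pverts T) \<union> (e1 \<inter> pverts T) \<union> (e2 \<inter> pverts T) \<union> (e3 \<inter> pverts T)"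
    unfolding point_set_def S(2) by blast
  moreover have "pverts S \<subseteq> pverts T" using assms by (simp add: triangle_of_def)
  ultimately show ?thesis unfolding S(3-5) using S(1) by blast
qed

lemma triangle_loop:
  assumes "triangle_of S T"
  obtains g where "simple_path g" "pathfinish g = pathstart g" "path_image g = point_set S"
proof -
  obtain a b c e1 e2 e3 where S: "a \<noteq> b" "b \<noteq> c" "a \<noteq> c"
    "pverts S = {a, b, c}" "parcs S = {e1, e2, e3}" "{e1, e2, e3} \<subseteq> parcs T"
    "e1 \<inter> pverts T = {a, b}" "e2 \<inter> pverts T = {b, c}" "e3 \<inter> pverts T = {a, c}"
    using triangle_structure[OF assms] .
  have ne: "e1 \<noteq> e2" "e2 \<noteq> e3" "e1 \<noteq> e3" using S by (auto simp: doubleton_eq_iff)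
  obtain g1 where g1: "arc g1" "path_image g1 = e1" "pathstart g1 = a" "pathfinish g1 = b"
    using arc_oriented[of e1 a b] S by auto
  obtain g2 where g2: "arc g2" "path_image g2 = e2" "pathstart g2 = b" "pathfinish g2 = c"
    using arc_oriented[of e2 b c] S by auto
  obtain g3 where g3: "arc g3" "path_image g3 = e3" "pathstart g3 = c" "pathfinish g3 = a"
    using arc_oriented[of e3 c a] S by (auto simp: insert_commute)
  have "e1 \<inter> e2 \<subseteq> {a, b} \<inter> {b, c}" "e1 \<inter> e3 \<subseteq> {a, b} \<inter> {a, c}" "e2 \<inter> e3 \<subseteq> {b, c} \<inter> {a, c}"
    using arcs_Int_subset S(6) ne unfolding S(7-9)[symmetric] by simp_all
  then have i: "e1 \<inter> e2 \<subseteq> {b}" "e1 \<inter> e3 \<subseteq> {a}" "e2 \<inter> e3 \<subseteq> {c}" using S(1-3) by auto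
  have 12: "arc (g1 +++ g2)" using g1 g2 i by (intro arc_join) auto
  have "simple_path ((g1 +++ g2) +++ g3)"
    using 12 g1 g2 g3 i by (intro simple_path_join_loop) (auto simp: path_image_join)
  moreover have "path_image ((g1 +++ g2) +++ g3) = point_set S"
    using g1 g2 g3 S by (auto simp: path_image_join point_set_def)
  ultimately show ?thesis using that[of "(g1 +++ g2) +++ g3"] g1 g3 by simp
qed

end

section \<open>The two sides of a triangle and gluing along it\<close>

text \<open>Symmetric in \<open>U\<close> and \<open>W\<close>, so one argument covers both the
  interior and the exterior part.\<close>

definition jordan_sides :: "complex set \<Rightarrow> complex set \<Rightarrow> complex set \<Rightarrow> bool" where
  "jordan_sides J U W \<longleftrightarrow> open U \<and> open W \<and> connected U \<and> connected W \<and> U \<inter> W = {} \<and>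
     U \<union> W = - J \<and> frontier U = J \<and> frontier W = J"

lemma jordan_sides_swap: "jordan_sides J U W \<Longrightarrow> jordan_sides J W U"
  by (auto simp: jordan_sides_def)

lemma (in plane) triangle_jordan_sides:
  assumes "triangle_of S T"
  shows "jordan_sides (point_set S) (inside (point_set S)) (outside (point_set S))"
proof -
  obtain g where "simple_path g" "pathfinish g = pathstart g" "path_image g = point_set S"
    using triangle_loop[OF assms] .
  then show ?thesis using Jordan_inside_outside[of g] by (simp add: jordan_sides_def)
qed

context plane
begin

lemma arc_in_triangle:
  assumes S: "triangle_of S T" and e: "e \<in> parcs T" "(e - pverts T) \<inter> point_set S \<noteq> {}"
  shows "e \<in> parcs S"
proof -
  obtain p where p: "p \<in> e" "p \<notin> pverts T" "p \<in> point_set S" using e(2) by blast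
  have sub: "pverts S \<subseteq> pverts T" "parcs S \<subseteq> parcs T" using S by (auto simp: triangle_of_def)
  then obtain f where "f \<in> parcs S" "p \<in> f" using p by (auto simp: point_set_def)
  then show ?thesis using arcs_meet[of e f p] e(1) p sub by blast
qed

text \<open>An open arc that avoids the triangle is connected and stays on one side. Its ends follow
  because a side together with the triangle is closed, as the complement of the other side.\<close>

lemma arc_on_side:
  assumes S: "triangle_of S T" and J: "jordan_sides (point_set S) U W" and e: "e \<in> parcs T"
  shows "e \<subseteq> point_set S \<union> U \<or> e \<subseteq> point_set S \<union> W"
proof (cases "(e - pverts T) \<inter> point_set S = {}")
  case True
  have "e - pverts T \<subseteq> U \<union> W" "U \<inter> W = {}" "open U" "open W" using True J by (auto simp: jordan_sides_def)
  then have "e - pverts T \<subseteq> U \<or> e - pverts T \<subseteq> W"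
    using open_arc_connected[OF e] connectedD[of "e - pverts T" U W] by blast
  moreover have "closed (point_set S \<union> U)" "closed (point_set S \<union> W)"
  proof -
    have "point_set S \<union> U = - W" "point_set S \<union> W = - U" using J by (auto simp: jordan_sides_def)
    then show "closed (point_set S \<union> U)" "closed (point_set S \<union> W)"
      using J by (auto simp: jordan_sides_def)
  qed
  ultimately show ?thesis using open_arc_dense[OF e] by (meson le_supI2)
next
  case False
  then have "e \<subseteq> point_set S" using arc_in_triangle[OF S e] by (auto simp: point_set_def)
  then show ?thesis by blast
qed

lemma triangle_arc_iff:
  assumes S: "triangle_of S T" and e: "e \<in> parcs T"
  shows "e \<subseteq> point_set S \<longleftrightarrow> e \<in> parcs S"
proof
  assume "e \<subseteq> point_set S"
  then have "(e - pverts T) \<inter> point_set S \<noteq> {}" using open_arc_nonempty[OF e] by blast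
  then show "e \<in> parcs S" using arc_in_triangle[OF S e] by blast
qed (auto simp: point_set_def)

lemma plane_restrict: "is_plane_graph (restrict_plane T R)"
proof -
  have eq: "e \<inter> (pverts T \<inter> R) = e \<inter> pverts T" if "e \<subseteq> R" for e using that by blast
  have "\<exists>g. arc g \<and> path_image g = e \<and> e \<inter> (pverts T \<inter> R) = {pathstart g, pathfinish g}"
    if "e \<in> parcs T" "e \<subseteq> R" for e
    using arc_param[OF that(1)] eq[OF that(2)] by metis
  moreover have "inj_on (\<lambda>e. e \<inter> (pverts T \<inter> R)) {e \<in> parcs T. e \<subseteq> R}"
    using arcs_inj eq by (auto simp: inj_on_def)
  moreover have "e \<inter> f \<subseteq> pverts T \<inter> R" if "e \<in> parcs T" "f \<in> parcs T" "e \<noteq> f" "e \<subseteq> R" for e f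
    using arcs_meet that by blast
  ultimately show ?thesis
    using finite_verts finite_arcs by (auto simp: is_plane_graph_def restrict_plane_def)
qed

lemma underlying_restrict:
  "underlying (restrict_plane T R) =
    \<lparr>uverts = pverts T \<inter> R, uedges = (\<lambda>e. e \<inter> pverts T) ` {e \<in> parcs T. e \<subseteq> R}\<rparr>"
proof -
  have "(\<lambda>e. e \<inter> (pverts T \<inter> R)) ` {e \<in> parcs T. e \<subseteq> R} = (\<lambda>e. e \<inter> pverts T) ` {e \<in> parcs T. e \<subseteq> R}"
    by (intro image_cong) auto
  then show ?thesis by (simp add: underlying_def restrict_plane_def)
qed

text \<open>The two closed sides intersect in the triangle, so arcs lying in both are its three
  arcs, and every arc lies in one of them. Injectivity of taking ends transfers this from arcs to
  edges.\<close>

lemma triangle_sum_of_sides: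
  assumes S: "triangle_of S T" and J: "jordan_sides (point_set S) U W"
  shows "\<exists>a b c. triangle_sum (underlying T) (underlying (restrict_plane T (point_set S \<union> U)))
    (underlying (restrict_plane T (point_set S \<union> W))) a b c"
proof -
  obtain a b c e1 e2 e3 where t: "a \<noteq> b" "b \<noteq> c" "a \<noteq> c"
    "pverts S = {a, b, c}" "parcs S = {e1, e2, e3}" "{e1, e2, e3} \<subseteq> parcs T"
    "e1 \<inter> pverts T = {a, b}" "e2 \<inter> pverts T = {b, c}" "e3 \<inter> pverts T = {a, c}"
    using triangle_structure[OF S] .
  let ?P = "point_set S" and ?f = "\<lambda>e. e \<inter> pverts T"
  let ?A = "{e \<in> parcs T. e \<subseteq> ?P \<union> U}" and ?B = "{e \<in> parcs T. e \<subseteq> ?P \<union> W}"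
  have UW: "U \<inter> W = {}" "(?P \<union> U) \<inter> (?P \<union> W) = ?P" using J by (auto simp: jordan_sides_def)
  have "?A \<inter> ?B = {e \<in> parcs T. e \<subseteq> ?P}" using UW by blast
  also have "\<dots> = {e1, e2, e3}" using triangle_arc_iff[OF S] t by auto
  finally have AB: "?A \<inter> ?B = {e1, e2, e3}" .
  have "?f ` ?A \<inter> ?f ` ?B = ?f ` (?A \<inter> ?B)"
    by (rule inj_on_image_Int[OF arcs_inj, symmetric]) auto
  then have meet: "?f ` ?A \<inter> ?f ` ?B = {{a, b}, {b, c}, {a, c}}" using AB t by simp
  have "?A \<union> ?B = parcs T" using arc_on_side[OF S J] by blast
  then have un: "?f ` parcs T = ?f ` ?A \<union> ?f ` ?B" by (metis image_Un)
  have "(pverts T \<inter> (?P \<union> U)) \<inter> (pverts T \<inter> (?P \<union> W)) = {a, b, c}"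
    using UW triangle_point_set_verts[OF S] t(4) by blast
  then have "triangle_sum (underlying T) (underlying (restrict_plane T (?P \<union> U)))
    (underlying (restrict_plane T (?P \<union> W))) a b c"
    using meet un t unfolding triangle_sum_def underlying_restrict subgraph_def
    by (simp add: underlying_def)
  then show ?thesis by blast
qed

lemma cdc_number_split:
  assumes "triangle_of S T"
  shows "cdc_number (underlying T) \<le>
    cdc_number (underlying (Int_triangle T S)) + cdc_number (underlying (Ext_triangle T S))"
  using triangle_sum_of_sides[OF assms triangle_jordan_sides[OF assms]]
  unfolding Int_triangle_def Ext_triangle_def by (elim exE) (rule triangle_sum.cdc_number_le)

end

lemma cdc_number_le_sum_pieces:
  assumes "pieces T P" "is_plane_graph T"
  shows "cdc_number (underlying T) \<le> (\<Sum>G\<in>#P. cdc_number (underlying G))"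
  using assms
proof (induction rule: pieces.induct)
  case (split S T P Q)
  interpret plane T using split by unfold_locales
  have "cdc_number (underlying T) \<le>
    cdc_number (underlying (Int_triangle T S)) + cdc_number (underlying (Ext_triangle T S))"
    using split cdc_number_split by (auto simp: separating_triangle_def)
  also have "\<dots> \<le> (\<Sum>G\<in>#P. cdc_number (underlying G)) + (\<Sum>G\<in>#Q. cdc_number (underlying G))"
    using split plane_restrict by (intro add_mono) (auto simp: Int_triangle_def Ext_triangle_def)
  finally show ?case by simp
qed simp

subsection \<open>Small separators of triangulations\<close>

definition (in plane) induced_drawing :: "complex set \<Rightarrow> complex set" where
  "induced_drawing X = X \<union> \<Union>{e \<in> parcs T. e \<inter> pverts T \<subseteq> X}"

locale triangulation = plane +
  assumes face_triangle: "F \<in> faces T \<Longrightarrow> \<exists>S. triangle_of S T \<and> frontier F = point_set S"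
begin

text \<open>A connected set that meets another but not its frontier is contained in it. With
  \<open>frontier F\<close> equal to the triangle this applies to \<open>F\<close> and a side in
  both directions.\<close>

lemma faces_eq_side:
  assumes F: "F \<in> faces T" "triangle_of S T" "frontier F = point_set S"
  shows "F = inside (point_set S) \<or> F = outside (point_set S)"
proof -
  let ?J = "point_set S"
  have sides: "jordan_sides ?J (inside ?J) (outside ?J)" using triangle_jordan_sides F(2) .
  have Fc: "connected F" "F \<noteq> {}" "F \<subseteq> - point_set T"
    using F(1) in_components_connected in_components_nonempty in_components_subset
    unfolding faces_def by blast+
  have "?J \<subseteq> point_set T" using F(2) by (auto simp: triangle_of_def point_set_def)
  then have FJ: "F \<inter> ?J = {}" using Fc(3) by blast
  have eq: "F = U" if J: "jordan_sides ?J U W" and ne: "F \<inter> U \<noteq> {}" for U W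
  proof
    show "F \<subseteq> U"
      using connected_Int_frontier[OF Fc(1) ne] FJ J unfolding jordan_sides_def by blast
    show "U \<subseteq> F"
      using connected_Int_frontier[of U F] ne J F(3) unfolding jordan_sides_def by blast
  qed
  have "F \<subseteq> inside ?J \<union> outside ?J" using FJ by auto
  then have "F \<inter> inside ?J \<noteq> {} \<or> F \<inter> outside ?J \<noteq> {}" using Fc(2) by blast
  then show ?thesis using eq[OF sides] eq[OF jordan_sides_swap[OF sides]] by blast
qed

text \<open>A face is the inside or the outside of a triangle, and there are finitely many choices
  of vertices and arcs for that triangle.\<close>

lemma finite_faces: "finite (faces T)"
proof -
  let ?P = "(\<lambda>(V, E). V \<union> \<Union>E) ` (Pow (pverts T) \<times> Pow (parcs T))"
  have sub: "faces T \<subseteq> inside ` ?P \<union> outside ` ?P"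
  proof
    fix F assume F: "F \<in> faces T"
    then obtain S where S: "triangle_of S T" "frontier F = point_set S" using face_triangle by blast
    then have "point_set S \<in> ?P"
      by (auto simp: triangle_of_def point_set_def intro!: image_eqI[of _ _ "(pverts S, parcs S)"])
    then show "F \<in> inside ` ?P \<union> outside ` ?P" using faces_eq_side[OF F S] by blast
  qed
  have "finite ?P" using finite_verts finite_arcs by simp
  then have "finite (inside ` ?P \<union> outside ` ?P)" by simp
  then show ?thesis by (rule finite_subset[OF sub])
qed

lemma closed_point_set_T: "closed (point_set T)" by (rule closed_point_set) auto

lemma open_face: "F \<in> faces T \<Longrightarrow> open F"
  unfolding faces_def by (rule open_components[OF open_Compl[OF closed_point_set_T]])

lemma face_disjoint_point_set: "F \<in> faces T \<Longrightarrow> F \<inter> point_set T = {}"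
  unfolding faces_def by (drule in_components_subset) blast

lemma faces_disjoint: "F \<in> faces T \<Longrightarrow> F' \<in> faces T \<Longrightarrow> p \<in> F \<Longrightarrow> p \<in> F' \<Longrightarrow> F = F'"
  unfolding faces_def by (drule (1) components_eq) blast

lemma point_cases:
  obtains "p \<in> pverts T" | e where "e \<in> parcs T" "p \<in> e - pverts T" | F where "F \<in> faces T" "p \<in> F"
proof -
  have "\<Union>(faces T) = - point_set T" by (simp add: faces_def)
  then show ?thesis using that unfolding point_set_def by blast
qed

lemma arc_meets_triangle:
  assumes S: "triangle_of S T" and e: "e \<in> parcs T" "p \<in> e - pverts T" "p \<in> point_set S"
  shows "e \<subseteq> point_set S"
  using arc_in_triangle[OF S e(1)] e by (auto simp: point_set_def)

section \<open>Open stars and connectivity after deleting vertices\<close>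

text \<open>The open star of \<open>A\<close> in the cell decomposition of the plane given by
  \<open>T\<close>. It turns a set of vertices into an open set without adding vertices.\<close>

definition star :: "complex set \<Rightarrow> complex set" where
  "star A = A \<union> \<Union>{e - pverts T | e. e \<in> parcs T \<and> e \<inter> A \<noteq> {}} \<union>
     \<Union>{F \<in> faces T. frontier F \<inter> A \<noteq> {}}"

lemma star_memI:
  "p \<in> A \<Longrightarrow> p \<in> star A"
  "e \<in> parcs T \<Longrightarrow> e \<inter> A \<noteq> {} \<Longrightarrow> p \<in> e - pverts T \<Longrightarrow> p \<in> star A"
  "F \<in> faces T \<Longrightarrow> frontier F \<inter> A \<noteq> {} \<Longrightarrow> p \<in> F \<Longrightarrow> p \<in> star A"
  unfolding star_def by blast+

lemma star_vertD:
  assumes "A \<subseteq> pverts T" "p \<in> star A" "p \<in> pverts T" shows "p \<in> A"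
  using assms face_disjoint_point_set unfolding star_def point_set_def by blast

lemma star_arcD:
  assumes "A \<subseteq> pverts T" "p \<in> star A" "e \<in> parcs T" "p \<in> e - pverts T" shows "e \<inter> A \<noteq> {}"
proof -
  have "p \<in> point_set T" using assms by (auto simp: point_set_def)
  then obtain f where "f \<in> parcs T" "f \<inter> A \<noteq> {}" "p \<in> f - pverts T"
    using assms face_disjoint_point_set unfolding star_def by blast
  then show ?thesis using arcs_meet[of e f p] assms by blast
qed

lemma star_faceD:
  assumes "A \<subseteq> pverts T" "p \<in> star A" "F \<in> faces T" "p \<in> F" shows "frontier F \<inter> A \<noteq> {}"
proof -
  have "p \<notin> point_set T" using assms face_disjoint_point_set by blast
  then have "p \<notin> A" "p \<notin> e - pverts T" if "e \<in> parcs T" for e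
    using assms(1) that by (auto simp: point_set_def)
  then obtain F' where "F' \<in> faces T" "frontier F' \<inter> A \<noteq> {}" "p \<in> F'"
    using assms(1,2) \<open>p \<notin> point_set T\<close> unfolding star_def point_set_def by blast
  then show ?thesis using faces_disjoint assms by blast
qed

lemma frontier_face_subset: "F \<in> faces T \<Longrightarrow> frontier F \<subseteq> point_set T"
  using face_triangle[of F] unfolding triangle_of_def point_set_def by blast

text \<open>The complement is a finite union of closed cells: the vertices outside \<open>A\<close>
  and the closures of the arcs and faces that avoid \<open>A\<close>. Finiteness of the set of faces
  makes it closed.\<close>

lemma open_star:
  assumes A: "A \<subseteq> pverts T" shows "open (star A)"
proof -
  define K where "K = (pverts T - A) \<union> \<Union>{e \<in> parcs T. e \<inter> A = {}} \<union>
    \<Union>(closure ` {F \<in> faces T. frontier F \<inter> A = {}})"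
  have "closed K"
    unfolding K_def using finite_verts finite_arcs finite_faces closed_arc
    by (intro closed_Un closed_Union finite_imp_closed) auto
  moreover have "star A = - K"
  proof (intro equalityI subsetI)
    fix p assume p: "p \<in> star A"
    have "p \<notin> pverts T - A" using star_vertD[OF A p] by blast
    moreover have "p \<notin> e" if "e \<in> parcs T" "e \<inter> A = {}" for e
      using star_vertD[OF A p] star_arcD[OF A p that(1)] that(2) by blast
    moreover have "p \<notin> closure F" if F: "F \<in> faces T" "frontier F \<inter> A = {}" for F
    proof
      assume "p \<in> closure F"
      then have "p \<in> F \<or> p \<in> frontier F" using closure_Un_frontier by blast
      then show False
      proof
        assume "p \<in> F"
        then show False using star_faceD[OF A p F(1)] F(2) by blast
      next
        \<comment> \<open>A frontier point is a vertex or an inner point of an arc. Since the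
          frontier is a triangle, it contains that arc entirely, with its ends, none of which is in
          \<open>A\<close>.\<close>
        assume pf: "p \<in> frontier F"
        obtain S where S: "triangle_of S T" "frontier F = point_set S" using face_triangle F(1) by blast
        show False
        proof (cases rule: point_cases[of p])
          case 1
          then show False using star_vertD[OF A p] pf F(2) by blast
        next
          case (2 e)
          then have "e \<subseteq> frontier F" using arc_meets_triangle[OF S(1) 2] pf S(2) by simp
          then show False using star_arcD[OF A p 2] F(2) by blast
        next
          case (3 F')
          then show False using pf frontier_face_subset[OF F(1)] face_disjoint_point_set by blast
        qed
      qed
    qed
    ultimately show "p \<in> - K" unfolding K_def by blast
  next
    fix p assume p: "p \<in> - K"
    show "p \<in> star A"
    proof (cases rule: point_cases[of p])
      case 1
      then show ?thesis using p star_memI(1) unfolding K_def by blast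
    next
      case (2 e)
      then have "e \<inter> A \<noteq> {}" using p unfolding K_def by blast
      then show ?thesis using star_memI(2) 2 by blast
    next
      case (3 F)
      then have "p \<in> closure F" using closure_subset by blast
      then have "frontier F \<inter> A \<noteq> {}" using p 3(1) unfolding K_def by blast
      then show ?thesis using star_memI(3) 3 by blast
    qed
  qed
  ultimately show ?thesis by (simp add: open_Compl)
qed

lemma triangle_edges:
  assumes "triangle_of S T" "x \<in> pverts S" "y \<in> pverts S" "x \<noteq> y"
  shows "{x, y} \<in> uedges (underlying T)"
proof -
  obtain a b c e1 e2 e3 where t: "a \<noteq> b" "b \<noteq> c" "a \<noteq> c"
    "pverts S = {a, b, c}" "parcs S = {e1, e2, e3}" "{e1, e2, e3} \<subseteq> parcs T"
    "e1 \<inter> pverts T = {a, b}" "e2 \<inter> pverts T = {b, c}" "e3 \<inter> pverts T = {a, c}"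
    using triangle_structure[OF assms(1)] .
  have "{a, b} \<in> uedges (underlying T)" "{b, c} \<in> uedges (underlying T)" "{a, c} \<in> uedges (underlying T)"
    using t(6) unfolding t(7-9)[symmetric] by (auto simp: underlying_def)
  then show ?thesis using assms(2-4) t(4) by (auto simp: insert_commute)
qed

text \<open>The stars of a component of \<open>T - X\<close> and of the remaining vertices, together with the
  faces all of whose vertices lie in \<open>X\<close>, partition the complement of the drawing of
  \<open>T[X]\<close> into open sets.\<close>

lemma connected_delete_verts:
  assumes X: "X \<subseteq> pverts T" and conn: "connected (- induced_drawing X)"
  shows "connected_graph (delete_verts (underlying T) X)"
proof (rule ccontr)
  let ?H = "delete_verts (underlying T) X"
  let ?r = "{(x, y). {x, y} \<in> uedges ?H}"
  have V: "uverts ?H = pverts T - X" by (simp add: delete_verts_def underlying_def)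
  assume "\<not> ?thesis"
  then obtain u w where uw: "u \<in> pverts T - X" "w \<in> pverts T - X" "(u, w) \<notin> ?r\<^sup>*"
    unfolding connected_graph_def V by blast
  define A where "A = {v \<in> pverts T - X. (u, v) \<in> ?r\<^sup>*}"
  define B where "B = pverts T - X - A"
  have sub: "A \<subseteq> pverts T" "B \<subseteq> pverts T" by (auto simp: A_def B_def)
  have AX: "A \<inter> X = {}" "B \<inter> X = {}" "A \<inter> B = {}" by (auto simp: A_def B_def)
  have no_edge: "{x, y} \<notin> uedges (underlying T)" if "x \<in> A" "y \<in> B" for x y
  proof
    assume "{x, y} \<in> uedges (underlying T)"
    then have "(x, y) \<in> ?r" using that AX by (auto simp: delete_verts_def)
    then have "(u, y) \<in> ?r\<^sup>*" using that(1) unfolding A_def by (auto intro: rtrancl_into_rtrancl)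
    then show False using that(2) by (auto simp: A_def B_def)
  qed
  \<comment> \<open>Faces with all corners in \<open>X\<close> touch neither part; they are put on
    the side of \<open>B\<close>.\<close>
  define W where "W = star B \<union> \<Union>{F \<in> faces T. frontier F \<inter> (A \<union> B) = {}}"
  have "open (star A)" using open_star sub by blast
  moreover have "open W"
    unfolding W_def using open_star sub open_face by (intro open_Un open_Union) auto
  moreover have "- induced_drawing X \<subseteq> star A \<union> W"
  proof
    fix p assume p: "p \<in> - induced_drawing X"
    show "p \<in> star A \<union> W"
    proof (cases rule: point_cases[of p])
      case 1
      then have "p \<in> A \<or> p \<in> B" using p by (auto simp: induced_drawing_def B_def)
      then show ?thesis using star_memI(1) unfolding W_def by blast
    next
      case (2 e)
      then have "\<not> e \<inter> pverts T \<subseteq> X" using p by (auto simp: induced_drawing_def)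
      then have "e \<inter> A \<noteq> {} \<or> e \<inter> B \<noteq> {}" by (auto simp: B_def)
      then show ?thesis using star_memI(2) 2 unfolding W_def by blast
    next
      case (3 F)
      consider "frontier F \<inter> A \<noteq> {}" | "frontier F \<inter> B \<noteq> {}" | "frontier F \<inter> (A \<union> B) = {}" by blast
      then show ?thesis
      proof cases
        case 1
        then show ?thesis using star_memI(3) 3 by blast
      next
        case 2
        then show ?thesis using star_memI(3) 3 unfolding W_def by blast
      next
        case none: 3
        then show ?thesis using 3 unfolding W_def by blast
      qed
    qed
  qed
  moreover have "star A \<inter> W = {}"
  proof (rule ccontr)
    assume "star A \<inter> W \<noteq> {}"
    then obtain p where p: "p \<in> star A" "p \<in> W" by blast
    show False
    proof (cases rule: point_cases[of p])
      case 1
      then have "p \<in> A" using star_vertD sub p by blast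
      moreover have "p \<in> star B"
        using p(2) 1 face_disjoint_point_set unfolding W_def point_set_def by blast
      then have "p \<in> B" using star_vertD sub 1 by blast
      ultimately show False using AX by blast
    next
      case (2 e)
      then have eA: "e \<inter> A \<noteq> {}" using star_arcD sub p by blast
      have "p \<in> star B"
        using p(2) 2 face_disjoint_point_set unfolding W_def point_set_def by blast
      then have eB: "e \<inter> B \<noteq> {}" using star_arcD sub 2 by blast
      obtain x y where xy: "x \<in> e" "x \<in> A" "y \<in> e" "y \<in> B" using eA eB by blast
      then have "x \<noteq> y" using AX by blast
      have "{x, y} \<subseteq> e \<inter> pverts T" using xy sub by blast
      moreover have "card {x, y} = card (e \<inter> pverts T)" using card_ends[OF 2(1)] \<open>x \<noteq> y\<close> by simp
      ultimately have "{x, y} = e \<inter> pverts T" using finite_verts by (intro card_subset_eq) auto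
      then have "{x, y} \<in> uedges (underlying T)" using 2(1) by (simp add: underlying_def)
      then show False using no_edge xy by blast
    next
      \<comment> \<open>Two corners of the triangle around a face are adjacent, so a face cannot
        have corners in both \<open>A\<close> and \<open>B\<close>.\<close>
      case (3 F)
      have fA: "frontier F \<inter> A \<noteq> {}" using star_faceD[OF sub(1) p(1) 3] .
      then have "p \<in> star B" using p(2) faces_disjoint[OF _ 3(1) _ 3(2)] unfolding W_def by blast
      then have fB: "frontier F \<inter> B \<noteq> {}" using star_faceD[OF sub(2) _ 3] by blast
      obtain S where S: "triangle_of S T" "frontier F = point_set S" using face_triangle 3(1) by blast
      obtain x y where "x \<in> point_set S \<inter> A" "y \<in> point_set S \<inter> B" using fA fB S(2) by blast
      then have xy: "x \<in> A" "y \<in> B" "x \<in> pverts S" "y \<in> pverts S"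
        using triangle_point_set_verts[OF S(1)] sub by blast+
      moreover have "x \<noteq> y" using xy AX by blast
      ultimately show False using no_edge triangle_edges[OF S(1)] by blast
    qed
  qed
  moreover have "u \<in> star A" "w \<in> W"
    using uw star_memI(1)[of u A] star_memI(1)[of w B] by (auto simp: A_def B_def W_def)
  moreover have "v \<notin> induced_drawing X" if "v \<in> pverts T - X" for v
    using that by (auto simp: induced_drawing_def)
  ultimately show False using connectedD[OF conn, of "star A" W] uw(1,2) by blast
qed

end

lemma two_pairs_in_triple:
  assumes "card p = 2" "card q = 2" "p \<noteq> q" "p \<union> q \<subseteq> X" "finite X" "card X \<le> 3"
  obtains x y z where "x \<noteq> y" "y \<noteq> z" "x \<noteq> z" "p = {x, y}" "q = {y, z}" "X = {x, y, z}"
proof -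
  have fin: "finite p" "finite q" using assms by (auto intro: finite_subset)
  have "card (p \<union> q) \<le> 3" using assms card_mono by (meson le_trans)
  then have "card (p \<inter> q) \<noteq> 0" using card_Un_Int[OF fin] assms by linarith
  then have "p \<inter> q \<noteq> {}" by (metis card.empty)
  then obtain y where y: "y \<in> p" "y \<in> q" by blast
  obtain x where x: "p = {x, y}" "x \<noteq> y" using assms(1) y(1) by (metis card_2_iff insertE insert_commute singletonD)
  obtain z where z: "q = {y, z}" "z \<noteq> y" using assms(2) y(2) by (metis card_2_iff insertE insert_commute singletonD)
  have "x \<noteq> z" using x z assms(3) by auto
  then have "card {x, y, z} = 3" using x(2) z(2) by simp
  then have "{x, y, z} = X" using assms(4-6) unfolding x(1) z(1) by (intro card_seteq) auto
  then show ?thesis using that[of x y z] x z \<open>x \<noteq> z\<close> by blast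
qed

context plane
begin

text \<open>Any two arcs of the drawing share an end, so one or two arcs form a single arc, whose
  complement is connected. Three arcs would form a triangle on \<open>X\<close>.\<close>

lemma connected_compl_drawing:
  assumes X: "X \<subseteq> pverts T" "card X \<le> 3" and no: "\<nexists>S. triangle_of S T \<and> pverts S = X"
  shows "connected (- induced_drawing X)"
proof -
  define E where "E = {e \<in> parcs T. e \<inter> pverts T \<subseteq> X}"
  have fX: "finite X" using X finite_verts finite_subset by blast
  have fE: "finite E" using finite_arcs by (simp add: E_def)
  \<comment> \<open>Removing finitely many points does not disconnect an open connected set in the
    plane, so isolated points of \<open>X\<close> do no harm.\<close>
  have del: "connected (- (X \<union> K))" if "closed K" "connected (- K)" for K :: "complex set"
  proof -
    have "connected (- K - X)" using that fX by (intro connected_open_delete_finite) auto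
    moreover have "- K - X = - (X \<union> K)" by blast
    ultimately show ?thesis by simp
  qed
  have pair: "\<exists>x y z. x \<noteq> y \<and> y \<noteq> z \<and> x \<noteq> z \<and> e \<inter> pverts T = {x, y} \<and> f \<inter> pverts T = {y, z} \<and> X = {x, y, z}"
    if ef: "e \<in> E" "f \<in> E" "e \<noteq> f" for e f
  proof -
    have "e \<inter> pverts T \<noteq> f \<inter> pverts T" using arcs_inj ef by (auto simp: E_def inj_on_def)
    moreover have "card (e \<inter> pverts T) = 2" "card (f \<inter> pverts T) = 2"
      "(e \<inter> pverts T) \<union> (f \<inter> pverts T) \<subseteq> X" using ef card_ends by (auto simp: E_def)
    ultimately obtain x y z where "x \<noteq> y" "y \<noteq> z" "x \<noteq> z"
      "e \<inter> pverts T = {x, y}" "f \<inter> pverts T = {y, z}" "X = {x, y, z}"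
      using two_pairs_in_triple[of "e \<inter> pverts T" "f \<inter> pverts T" X] fX X(2) by metis
    then show ?thesis by blast
  qed
  consider "E = {}" | e where "E = {e}" | e f where "E = {e, f}" "e \<noteq> f"
    | e f g where "{e, f, g} \<subseteq> E" "e \<noteq> f" "e \<noteq> g" "f \<noteq> g"
  proof -
    consider "card E = 0" | "card E = 1" | "card E = 2" | "3 \<le> card E" by linarith
    then show ?thesis
    proof cases
      case 1
      then show ?thesis using that(1) fE by simp
    next
      case 2
      then show ?thesis using that(2) by (meson card_1_singletonE)
    next
      case 3
      then show ?thesis using that(3) by (meson card_2_iff)
    next
      case 4
      then obtain D where "D \<subseteq> E" "card D = 3" by (meson obtain_subset_with_card_n)
      then show ?thesis using that(4) by (metis card_3_iff)
    qed
  qed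
  then have "connected (- (X \<union> \<Union>E))"
  proof cases
    case 1
    then show ?thesis using del[of "{}"] connected_UNIV by simp
  next
    case (2 e)
    then have e: "e \<in> parcs T" by (auto simp: E_def)
    obtain g where "arc g" "path_image g = e" using arc_param[OF e] by metis
    then have "connected (- e)" using connected_arc_complement[of g] by auto
    then show ?thesis using del[of e] closed_arc[OF e] 2 by simp
  next
    case (3 e f)
    obtain x y z where xyz: "x \<noteq> y" "y \<noteq> z" "x \<noteq> z" "e \<inter> pverts T = {x, y}" "f \<inter> pverts T = {y, z}"
      using pair[of e f] 3 by blast
    have ef: "e \<in> parcs T" "f \<in> parcs T" using 3 by (auto simp: E_def)
    obtain g where g: "arc g" "path_image g = e" "pathstart g = x" "pathfinish g = y"
      using arc_oriented[OF ef(1) xyz(4)] .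
    obtain h where h: "arc h" "path_image h = f" "pathstart h = y" "pathfinish h = z"
      using arc_oriented[OF ef(2) xyz(5)] .
    have "e \<inter> f \<subseteq> {x, y} \<inter> {y, z}" using arcs_Int_subset[OF ef 3(2)] xyz(4,5) by simp
    then have "e \<inter> f \<subseteq> {y}" using xyz by auto
    then have "arc (g +++ h)" using g h by (intro arc_join) auto
    moreover have "path_image (g +++ h) = e \<union> f" using g h by (simp add: path_image_join)
    ultimately have "connected (- (e \<union> f))" using connected_arc_complement[of "g +++ h"] by auto
    then show ?thesis using del[of "e \<union> f"] closed_arc ef 3 by (simp add: closed_Un)
  next
    \<comment> \<open>Two arcs already use the pairs \<open>{x, y}\<close> and
      \<open>{y, z}\<close>; for a third one only \<open>{x, z}\<close> remains.\<close>
    case (4 e f g)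
    then obtain x y z where xyz: "x \<noteq> y" "y \<noteq> z" "x \<noteq> z" "e \<inter> pverts T = {x, y}" "f \<inter> pverts T = {y, z}"
      "X = {x, y, z}" using pair[of e f] by blast
    have in_T: "{e, f, g} \<subseteq> parcs T" using 4 by (auto simp: E_def)
    have g: "card (g \<inter> pverts T) = 2" "g \<inter> pverts T \<subseteq> {x, y, z}" using 4 in_T card_ends xyz(6) by (auto simp: E_def)
    have ne: "g \<inter> pverts T \<noteq> {x, y}" "g \<inter> pverts T \<noteq> {y, z}"
      unfolding xyz(4)[symmetric] xyz(5)[symmetric] using arcs_inj 4 in_T by (auto simp: inj_on_def)
    obtain p q where pq: "g \<inter> pverts T = {p, q}" "p \<noteq> q" using g(1) by (meson card_2_iff)
    then have "p \<in> {x, y, z}" "q \<in> {x, y, z}" using g(2) by blast+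
    then have "g \<inter> pverts T = {x, z}" using ne pq by auto
    then have "triangle_of \<lparr>pverts = {x, y, z}, parcs = {e, f, g}\<rparr> T"
      using triangleI[of x y z e f g] xyz in_T by blast
    then show ?thesis using no xyz(6) by (metis plane_graph.select_convs(1))
  qed
  then show ?thesis by (simp add: E_def induced_drawing_def)
qed

end

subsection \<open>Pieces\<close>

lemma plane_triangulation_iff: "plane_triangulation T \<longleftrightarrow> triangulation T"
  by (auto simp: plane_triangulation_def triangulation_def plane_def triangulation_axioms_def)

text \<open>There are no parallel arcs, so an arc between two corners of \<open>S\<close> is the arc
  of \<open>S\<close> between them.\<close>

lemma (in plane) triangle_induced_arc:
  assumes S: "triangle_of S T" and e: "e \<in> parcs T" "e \<inter> pverts T \<subseteq> pverts S"
  shows "e \<in> parcs S"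
proof -
  obtain a b c e1 e2 e3 where t: "a \<noteq> b" "b \<noteq> c" "a \<noteq> c"
    "pverts S = {a, b, c}" "parcs S = {e1, e2, e3}" "{e1, e2, e3} \<subseteq> parcs T"
    "e1 \<inter> pverts T = {a, b}" "e2 \<inter> pverts T = {b, c}" "e3 \<inter> pverts T = {a, c}"
    using triangle_structure[OF S] .
  obtain p q where pq: "e \<inter> pverts T = {p, q}" "p \<noteq> q" using card_ends[OF e(1)] by (meson card_2_iff)
  then have "p \<in> {a, b, c}" "q \<in> {a, b, c}" using e(2) t(4) by blast+
  then have "e \<inter> pverts T = {a, b} \<or> e \<inter> pverts T = {b, c} \<or> e \<inter> pverts T = {a, c}"
    using pq by auto
  then have "\<exists>f\<in>parcs S. e \<inter> pverts T = f \<inter> pverts T" unfolding t(5) t(7-9)[symmetric] by blast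
  then obtain f where f: "f \<in> parcs S" "e \<inter> pverts T = f \<inter> pverts T" by blast
  have "f \<in> parcs T" using f(1) S by (auto simp: triangle_of_def)
  then have "e = f" by (rule inj_onD[OF arcs_inj f(2) e(1)])
  then show ?thesis using f(1) by simp
qed

context triangulation
begin

text \<open>Removing what is drawn in \<open>W\<close> merges all of \<open>W\<close> into one face
  bounded by \<open>S\<close>, while the faces inside \<open>U\<close> are faces of
  \<open>T\<close>.\<close>

lemma triangulation_restrict:
  assumes S: "triangle_of S T" and J: "jordan_sides (point_set S) U W"
  shows "plane_triangulation (restrict_plane T (point_set S \<union> U))"
proof -
  let ?P = "point_set S" and ?H = "restrict_plane T (point_set S \<union> U)"
  have UW: "U \<inter> W = {}" "U \<union> W = - ?P" "connected W" "frontier U = ?P" "frontier W = ?P"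
    using J by (auto simp: jordan_sides_def)
  have ps: "point_set ?H = (pverts T \<inter> (?P \<union> U)) \<union> \<Union>{e \<in> parcs T. e \<subseteq> ?P \<union> U}"
    by (simp add: point_set_def restrict_plane_def)
  have HR: "point_set ?H \<subseteq> ?P \<union> U" unfolding ps by blast
  have HT: "point_set ?H \<subseteq> point_set T" unfolding ps by (auto simp: point_set_def[of T])
  have TU: "point_set T \<inter> U \<subseteq> point_set ?H"
  proof
    fix p assume p: "p \<in> point_set T \<inter> U"
    show "p \<in> point_set ?H"
    proof (cases "p \<in> pverts T")
      case True
      then show ?thesis using p unfolding ps by blast
    next
      case False
      then obtain e where e: "e \<in> parcs T" "p \<in> e" using p by (auto simp: point_set_def)
      then have "\<not> e \<subseteq> ?P \<union> W" using p UW by blast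
      then have "e \<subseteq> ?P \<union> U" using arc_on_side[OF S J e(1)] by blast
      then show ?thesis using e unfolding ps by blast
    qed
  qed
  have tri: "triangle_of S' ?H" if "triangle_of S' T" "point_set S' \<subseteq> ?P \<union> U" for S'
    using that by (auto simp: triangle_of_def restrict_plane_def point_set_def)
  have PH: "?P \<subseteq> point_set ?H"
    using tri[OF S] by (auto simp: triangle_of_def point_set_def)
  have "\<exists>S'. triangle_of S' ?H \<and> frontier F = point_set S'" if F: "F \<in> faces ?H" for F
  proof -
    have comp: "F \<in> components (- point_set ?H)" using F by (simp add: faces_def)
    then have Fc: "connected F" "F \<inter> point_set ?H = {}"
      using in_components_connected in_components_subset by blast+
    show ?thesis
    proof (cases "F \<inter> W = {}")
      \<comment> \<open>\<open>W\<close> is connected and free of the restricted drawing, so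
        \<open>F\<close> contains it; conversely \<open>F\<close> cannot cross the frontier of
        \<open>W\<close>, which is drawn.\<close>
      case False
      have "W \<subseteq> - point_set ?H" using HR UW by blast
      then have "W \<subseteq> F" using components_maximal[OF comp UW(3)] False by blast
      moreover have "F \<subseteq> W"
        using connected_Int_frontier[OF Fc(1) False] Fc(2) PH UW(5) by blast
      ultimately have "F = W" by blast
      then show ?thesis using tri[OF S] UW(5) by blast
    next
      \<comment> \<open>Inside \<open>U\<close> both drawings have the same points, so
        \<open>F\<close> is a face of \<open>T\<close>, and its triangle lies in the closure of
        \<open>U\<close>.\<close>
      case True
      then have FU: "F \<subseteq> U" using Fc(2) PH UW(2) by blast
      then have "F \<subseteq> - point_set T" using TU Fc(2) by blast
      then have "F \<in> faces T"
        unfolding faces_def using components_intermediate_subset[OF comp] HT by blast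
      then obtain S' where S': "triangle_of S' T" "frontier F = point_set S'" using face_triangle by blast
      have "frontier F \<subseteq> closure U" using closure_mono[OF FU] by (auto simp: frontier_def)
      then have "frontier F \<subseteq> ?P \<union> U" using UW(4) closure_Un_frontier[of U] by blast
      then show ?thesis using tri[of S'] S' by auto
    qed
  qed
  then show ?thesis using plane_restrict by (simp add: plane_triangulation_def)
qed

text \<open>With fewer than four vertices, the side of \<open>U\<close> has just the three corners
  of \<open>S\<close>. Any arc drawn there joins corners and so belongs to \<open>S\<close>; the
  other part loses nothing.\<close>

lemma restrict_other_side_eq:
  assumes S: "triangle_of S T" and J: "jordan_sides (point_set S) U W"
    and small: "\<not> card (pverts (restrict_plane T (point_set S \<union> U))) \<ge> 4"
  shows "restrict_plane T (point_set S \<union> W) = T"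
proof -
  let ?P = "point_set S" and ?V = "pverts T \<inter> (point_set S \<union> U)"
  have UW: "U \<inter> W = {}" "U \<union> W = - ?P" using J by (auto simp: jordan_sides_def)
  have "pverts S \<subseteq> ?V" using triangle_point_set_verts[OF S] by blast
  moreover have "card (pverts S) = 3" using S by (simp add: triangle_of_def)
  moreover have "card ?V \<le> 3" using small by (simp add: restrict_plane_def)
  ultimately have V: "?V = pverts S" using finite_verts by (metis card_seteq finite_Int)
  have "e \<subseteq> ?P \<union> W" if e: "e \<in> parcs T" for e
  proof (rule ccontr)
    assume n: "\<not> e \<subseteq> ?P \<union> W"
    then have "e \<subseteq> ?P \<union> U" using arc_on_side[OF S J e] by blast
    then have "e \<inter> pverts T \<subseteq> pverts S" using V by blast
    then have "e \<in> parcs S" using triangle_induced_arc[OF S e] by blast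
    then show False using n by (auto simp: point_set_def)
  qed
  moreover have "pverts T \<subseteq> ?P \<union> W"
  proof
    fix p assume p: "p \<in> pverts T"
    show "p \<in> ?P \<union> W"
    proof (cases "p \<in> U")
      case True
      then have "p \<in> pverts S" using V p by blast
      then show ?thesis by (simp add: point_set_def)
    qed (use UW(2) in blast)
  qed
  ultimately have "pverts T \<inter> (?P \<union> W) = pverts T" "{e \<in> parcs T. e \<subseteq> ?P \<union> W} = parcs T" by blast+
  then show ?thesis by (simp add: restrict_plane_def)
qed

lemma connected_delete_le_3:
  assumes "\<nexists>S. separating_triangle S T" "X \<subseteq> pverts T" "card X \<le> 3"
  shows "connected_graph (delete_verts (underlying T) X)"
proof (cases "\<exists>S. triangle_of S T \<and> pverts S = X")
  case True
  then show ?thesis using assms(1) by (auto simp: separating_triangle_def)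
next
  case False
  then show ?thesis using connected_delete_verts connected_compl_drawing assms by blast
qed

lemma uedges_underlying: "e \<in> uedges (underlying T) \<Longrightarrow> e \<subseteq> pverts T \<and> card e = 2"
  using card_ends by (auto simp: underlying_def)

text \<open>Deleting the other two vertices leaves a connected graph on \<open>u\<close> and
  \<open>w\<close>, which must contain the edge between them.\<close>

lemma four_vertices_complete:
  assumes "\<nexists>S. separating_triangle S T" "card (pverts T) = 4"
  shows "uedges (underlying T) = {e. e \<subseteq> pverts T \<and> card e = 2}"
proof (intro equalityI subsetI)
  fix e assume "e \<in> {e. e \<subseteq> pverts T \<and> card e = 2}"
  then obtain u w where uw: "e = {u, w}" "u \<noteq> w" "u \<in> pverts T" "w \<in> pverts T"
    by (auto simp: card_2_iff)
  let ?X = "pverts T - {u, w}"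
  let ?H = "delete_verts (underlying T) ?X"
  have "card ?X = 2" using uw assms(2) finite_verts by (simp add: card_Diff_subset)
  then have "connected_graph ?H" using connected_delete_le_3 assms(1) by simp
  then have "(u, w) \<in> {(x, y). {x, y} \<in> uedges ?H}\<^sup>*"
    using uw by (auto simp: connected_graph_def delete_verts_def underlying_def)
  then obtain y where y: "{u, y} \<in> uedges ?H" using uw(2) by (auto elim: converse_rtranclE)
  then have uy: "{u, y} \<in> uedges (underlying T)" "{u, y} \<inter> ?X = {}" by (auto simp: delete_verts_def)
  have "y \<in> pverts T" "card {u, y} = 2" using uedges_underlying[OF uy(1)] by auto
  then have "y = w" using uy(2) by (cases "u = y") auto
  then show "e \<in> uedges (underlying T)" using uy(1) uw(1) by simp
qed (use uedges_underlying in blast)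

end

lemma complete_graph_iso:
  assumes "finite (uverts G)" "card (uverts G) = n" "uedges G = {e. e \<subseteq> uverts G \<and> card e = 2}"
  shows "graph_iso G (complete_graph n)"
proof -
  obtain f where f: "bij_betw f (uverts G) {..<n}"
    using ex_bij_betw_finite_nat[OF assms(1)] assms(2) by (auto simp: atLeast0LessThan)
  have inj: "inj_on f (uverts G)" and im: "f ` uverts G = {..<n}" using f by (auto simp: bij_betw_def)
  have "{e. e \<subseteq> {..<n} \<and> card e = 2} = (`) f ` uedges G"
  proof (intro equalityI subsetI)
    fix e assume "e \<in> {e. e \<subseteq> {..<n} \<and> card e = 2}"
    then have e: "e \<subseteq> f ` uverts G" "card e = 2" using im by auto
    then obtain d where d: "d \<subseteq> uverts G" "e = f ` d" by (meson subset_imageE)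
    then have "card d = 2" using e(2) inj card_image by (metis inj_on_subset)
    then show "e \<in> (`) f ` uedges G" using d assms(3) by blast
  next
    fix e assume "e \<in> (`) f ` uedges G"
    then obtain d where d: "d \<subseteq> uverts G" "card d = 2" "e = f ` d" using assms(3) by blast
    then have "card e = 2" using inj card_image by (metis inj_on_subset)
    then show "e \<in> {e. e \<subseteq> {..<n} \<and> card e = 2}" using d im by blast
  qed
  then show ?thesis using f unfolding graph_iso_def complete_graph_def by auto
qed

text \<open>The cover consists of the three Hamiltonian cycles of \<open>K\<^sub>4\<close>.\<close>

lemma cdc_number_complete_4:
  fixes G :: "'a ugraph"
  assumes "card (uverts G) = 4" "uedges G = {e. e \<subseteq> uverts G \<and> card e = 2}"
  shows "cdc_number G \<le> 3"
proof -
  obtain xs where xs: "set xs = uverts G" "distinct xs"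
    using assms(1) finite_distinct_list by (metis card.infinite zero_neq_numeral)
  then have "length xs = Suc (Suc (Suc (Suc 0)))" using assms(1) distinct_card[of xs] by simp
  then obtain a b c d where "xs = [a, b, c, d]"
    by (auto simp: length_Suc_conv)
  then have V: "uverts G = {a, b, c, d}" and d: "distinct [a, b, c, d]" using xs by auto
  let ?M = "{#list_cycle [a, b, c, d], list_cycle [a, b, d, c], list_cycle [a, c, b, d]#}"
  have E: "uedges G = {{a, b}, {a, c}, {a, d}, {b, c}, {b, d}, {c, d}}"
  proof (intro equalityI subsetI)
    fix e assume "e \<in> uedges G"
    then have e: "e \<subseteq> {a, b, c, d}" "card e = 2" using assms(2) V by auto
    obtain x y where xy: "e = {x, y}" "x \<noteq> y" using e(2) by (meson card_2_iff)
    then have "x \<in> {a, b, c, d}" "y \<in> {a, b, c, d}" using e(1) by auto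
    then show "e \<in> {{a, b}, {a, c}, {a, d}, {b, c}, {b, d}, {c, d}}"
      using xy by (elim insertE) (simp_all add: doubleton_eq_iff)
  next
    fix e assume "e \<in> {{a, b}, {a, c}, {a, d}, {b, c}, {b, d}, {c, d}}"
    then have "e \<subseteq> {a, b, c, d} \<and> card e = 2" using d by (elim insertE) simp_all
    then show "e \<in> uedges G" unfolding assms(2) V by simp
  qed
  have cyc: "is_cycle C \<and> subgraph C G" if CM: "C \<in># ?M" for C
  proof
    have "\<exists>L. C = list_cycle L \<and> distinct L \<and> length L = 4 \<and> set L = {a, b, c, d}"
    proof -
      consider "C = list_cycle [a, b, c, d]" | "C = list_cycle [a, b, d, c]" | "C = list_cycle [a, c, b, d]"
        using CM by (simp only: set_mset_add_mset_insert set_mset_empty) blast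
      then show ?thesis
      proof cases
        case 1
        then show ?thesis using d by (intro exI[of _ "[a, b, c, d]"]) simp
      next
        case 2
        then show ?thesis using d by (intro exI[of _ "[a, b, d, c]"]) auto
      next
        case 3
        then show ?thesis using d by (intro exI[of _ "[a, c, b, d]"]) auto
      qed
    qed
    then obtain L where L: "C = list_cycle L" "distinct L" "length L = 4" "set L = {a, b, c, d}" by blast
    show C: "is_cycle C" unfolding L(1) by (rule is_cycle_list_cycle) (simp_all add: L)
    have sub: "uverts C \<subseteq> uverts G" unfolding L(1) V L(4)[symmetric] by (simp add: list_cycle_def)
    have "e \<in> uedges G" if "e \<in> uedges C" for e
    proof -
      have "e \<subseteq> uverts C" "card e = 2" using C that by (simp_all add: is_cycle_def simple_graph_def)
      then show ?thesis using sub unfolding assms(2) by blast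
    qed
    then show "subgraph C G" using sub unfolding subgraph_def by blast
  qed
  have L: "uedges (list_cycle [w, x, y, z]) = {{w, x}, {x, y}, {y, z}, {z, w}}" for w x y z :: 'a
    by (simp add: list_cycle_def closed_walk_edges_def)
  have "edge_mult ?M e = 2" if e: "e \<in> uedges G" for e
  proof -
    have "e = {a, b} \<or> e = {a, c} \<or> e = {a, d} \<or> e = {b, c} \<or> e = {b, d} \<or> e = {c, d}"
      using e by (simp add: E)
    \<comment> \<open>Supplies every inequality between the vertices in the opposite orientation for
      simplification.\<close>
    moreover have "distinct [d, c, b, a]" using d by auto
    ultimately show ?thesis using d by (elim disjE) (simp_all add: L doubleton_eq_iff)
  qed
  then have "cycle_double_cover G ?M" using cyc by (auto simp: cycle_double_cover_iff)
  then have "cdc_number G \<le> enat (size ?M)" unfolding cdc_number_def by (intro INF_lower) simp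
  then show ?thesis by (simp add: numeral_eq_enat numeral_3_eq_3)
qed

text \<open>Both summands of the bound are additive over unions of multisets, so the gluing
  inequality carries it through a split. The lower bound of four vertices has to be re-established
  for the parts.\<close>

lemma cdc_number_le_piece_weights:
  assumes "pieces T P" "plane_triangulation T" "card (pverts T) \<ge> 4"
    and hyp: "\<And>G. plane_triangulation G \<Longrightarrow> k_connected 4 (underlying G) \<Longrightarrow>
      \<exists>M. cycle_double_cover (underlying G) M \<and> size M \<le> card (pverts G) - 2"
  shows "cdc_number (underlying T) \<le>
    enat (3 * size (K4_pieces P) + (\<Sum>G\<in>#four_connected_pieces P. card (pverts G) - 2))"
  using assms(1-3)
proof (induction rule: pieces.induct)
  case (whole T)
  interpret triangulation T using whole.prems by (simp add: plane_triangulation_iff)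
  show ?case
  proof (cases "card (pverts T) = 4")
    case True
    then have E: "uedges (underlying T) = {e. e \<subseteq> uverts (underlying T) \<and> card e = 2}"
      "card (uverts (underlying T)) = 4" "finite (uverts (underlying T))"
      using four_vertices_complete[OF whole.hyps] finite_verts by (simp_all add: underlying_def)
    then have "graph_iso (underlying T) (complete_graph 4)" using complete_graph_iso by blast
    \<comment> \<open>The value \<open>m - 2 = 2\<close> is out of reach for \<open>K_4\<close>: its
      six edges give twelve incidences, and no cycle is longer than four.\<close>
    then have "3 \<le> 3 * size (K4_pieces {#T#})" by (simp add: K4_pieces_def)
    then have "enat 3 \<le> enat (3 * size (K4_pieces {#T#}) +
        (\<Sum>G\<in>#four_connected_pieces {#T#}. card (pverts G) - 2))" by simp
    moreover have "cdc_number (underlying T) \<le> enat 3"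
      using cdc_number_complete_4[OF E(2,1)] by (simp add: numeral_eq_enat)
    ultimately show ?thesis using order_trans by blast
  next
    case False
    then have "card (pverts T) > 4" using whole.prems by simp
    then have k: "k_connected 4 (underlying T)"
      using connected_delete_le_3[OF whole.hyps] by (auto simp: k_connected_def underlying_def)
    then obtain M where "cycle_double_cover (underlying T) M" "size M \<le> card (pverts T) - 2"
      using hyp whole.prems by blast
    then have "cdc_number (underlying T) \<le> enat (card (pverts T) - 2)"
      unfolding cdc_number_def by (intro INF_lower2[of M]) auto
    also have "\<dots> \<le> enat (3 * size (K4_pieces {#T#}) +
        (\<Sum>G\<in>#four_connected_pieces {#T#}. card (pverts G) - 2))"
      using k by (simp add: four_connected_pieces_def)
    finally show ?thesis .
  qed
next
  case (split S T P Q)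
  interpret triangulation T using split.prems by (simp add: plane_triangulation_iff)
  define weight where "weight P = 3 * size (K4_pieces P) +
    (\<Sum>G\<in>#four_connected_pieces P. card (pverts G) - 2)" for P
  have weight_add: "weight (P + Q) = weight P + weight Q"
    by (simp add: weight_def K4_pieces_def four_connected_pieces_def)
  have S: "triangle_of S T" using split.hyps by (simp add: separating_triangle_def)
  note sides = triangle_jordan_sides[OF S]
  have tri: "plane_triangulation (Int_triangle T S)" "plane_triangulation (Ext_triangle T S)"
    unfolding Int_triangle_def Ext_triangle_def
    using triangulation_restrict[OF S sides] triangulation_restrict[OF S jordan_sides_swap[OF sides]] .
  have IH: "card (pverts (Int_triangle T S)) \<ge> 4 \<Longrightarrow> cdc_number (underlying (Int_triangle T S)) \<le> enat (weight P)"
    "card (pverts (Ext_triangle T S)) \<ge> 4 \<Longrightarrow> cdc_number (underlying (Ext_triangle T S)) \<le> enat (weight Q)"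
    using split.IH tri unfolding weight_def by blast+
  have "cdc_number (underlying T) \<le> enat (weight (P + Q))"
  proof (cases "card (pverts (Int_triangle T S)) \<ge> 4 \<and> card (pverts (Ext_triangle T S)) \<ge> 4")
    case True
    have "cdc_number (underlying T) \<le>
      cdc_number (underlying (Int_triangle T S)) + cdc_number (underlying (Ext_triangle T S))"
      using cdc_number_split[OF S] .
    also have "\<dots> \<le> enat (weight P) + enat (weight Q)" using IH True by (intro add_mono) auto
    finally show ?thesis by (simp add: weight_add)
  next
    case False
    \<comment> \<open>Impossible for a separating triangle, but harmless: an empty side leaves \<open>T\<close> unchanged.\<close>
    then have "Ext_triangle T S = T \<or> Int_triangle T S = T"
      using restrict_other_side_eq[OF S sides] restrict_other_side_eq[OF S jordan_sides_swap[OF sides]]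
      unfolding Int_triangle_def Ext_triangle_def by blast
    then have "cdc_number (underlying T) \<le> enat (weight P) \<or> cdc_number (underlying T) \<le> enat (weight Q)"
      using IH split.prems(2) by auto
    then show ?thesis by (auto simp: weight_add intro: order_trans)
  qed
  then show ?case by (simp add: weight_def)
qed

theorem theorem3:
  fixes T :: plane_graph and P :: "plane_graph multiset"
  assumes "plane_triangulation T"
    and "card (pverts T) \<ge> 4"
    and "pieces T P"
  shows "cdc_number (underlying T) \<le> (\<Sum>G\<in>#P. cdc_number (underlying G)) \<and>
    ((\<forall>m G. plane_triangulation G \<and> k_connected 4 (underlying G) \<and> card (pverts G) = m \<longrightarrow>
        (\<exists>M. cycle_double_cover (underlying G) M \<and> size M \<le> m - 2)) \<longrightarrow>
     cdc_number (underlying T) \<le>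
       enat (3 * size (K4_pieces P) + (\<Sum>G\<in>#four_connected_pieces P. card (pverts G) - 2)))"
proof (intro conjI impI)
  show "cdc_number (underlying T) \<le> (\<Sum>G\<in>#P. cdc_number (underlying G))"
    using cdc_number_le_sum_pieces assms by (simp add: plane_triangulation_def)
next
  assume "\<forall>m G. plane_triangulation G \<and> k_connected 4 (underlying G) \<and> card (pverts G) = m \<longrightarrow>
    (\<exists>M. cycle_double_cover (underlying G) M \<and> size M \<le> m - 2)"
  then show "cdc_number (underlying T) \<le>
      enat (3 * size (K4_pieces P) + (\<Sum>G\<in>#four_connected_pieces P. card (pverts G) - 2))"
    using cdc_number_le_piece_weights[OF assms(3,1,2)] by blast
qed

end
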